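(* Let $(M,g)$ be a light-like manifold with constant index and nullity degree $r$. Assume that $Rad(TM)$ is a trivial bundle, with everywhere linearly independent vector fields $\xi_i\in\Gamma(Rad(TM))$, $i=1,\dots,r$. Let $\tau_i$ ($i=1,\dots,r$) be smooth 1-forms on $M$ satisfying $\tau_i(\xi_j)=\delta_{ij}$ for $i,j=1,\dots,r$. Let $T$ be a torsion tensor (an anti-symmetric $(1,2)$-tensor field) and $Q$ a non-metricity tensor (a $(0,3)$-tensor field symmetric in its last two variables) on $M$ satisfying, for all $X,Y\in\Gamma(TM)$ and $i=1,\dots,r$, $$(d\tau_i)(X,Y)=\tau_i(T(X,Y)),$$ $$(L_{\xi_i}g)(X,Y)=g(X,T(\xi_i,Y))+g(Y,T(\xi_i,X))+Q(\xi_i,X,Y)-Q(X,Y,\xi_i)-Q(Y,X,\xi_i).$$ Then there exists a unique linear connection $\nabla$ on $M$ having torsion $T$, having non-metricity $Q$ for $g$ (i.e. $(\nabla_Zg)(X,Y)=Q(Z,X,Y)$ for all $X,Y,Z\in\Gamma(TM)$), and making the 1-forms $\tau_i$ parallel (i.e. $\nabla_X\tau_i=0$ for all $X\in\Gamma(TM)$, $i=1,\dots,r$).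
   Context: A light-like manifold $(M,g)$ is a smooth manifold $M$ with a smooth symmetric $(0,2)$-tensor field $g$ of constant index and constant nullity degree (co-rank). $Rad(TM)$ is the radical of $g$: the subbundle of $TM$ with fibres $Rad(T_xM)=\{v\in T_xM : g(v,w)=0 \text{ for all } w\in T_xM\}$; its rank equals the nullity degree. $\Gamma(E)$ denotes the space of smooth sections of a bundle $E$. $L$ denotes the Lie derivative. The torsion of a linear connection $\nabla$ is $T(X,Y)=\nabla_XY-\nabla_YX-[X,Y]$. Conventions: $(d\tau)(X,Y)=X\tau(Y)-Y\tau(X)-\tau([X,Y])$, $(\nabla_Zg)(X,Y)=Z(g(X,Y))-g(\nabla_ZX,Y)-g(X,\nabla_ZY)$, $(\nabla_X\tau)(Y)=X(\tau(Y))-\tau(\nabla_XY)$, $(L_\xi g)(X,Y)=\xi(g(X,Y))-g([\xi,X],Y)-g(X,[\xi,Y])$. *)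

theory Defs
  imports "HOL-Analysis.Analysis" "HOL-Library.Function_Algebras" "HOL-Library.FuncSet"
begin

text \<open>The pointwise vector space structure on functions makes \<open>subspace\<close>, \<open>independent\<close>
  and \<open>dim\<close> available for tangent vectors, which are functionals on functions below.\<close>

instantiation "fun" :: (type, scaleR) scaleR
begin
definition scaleR_fun :: "real \<Rightarrow> ('a \<Rightarrow> 'b) \<Rightarrow> 'a \<Rightarrow> 'b"
  where "scaleR_fun c f = (\<lambda>x. c *\<^sub>R f x)"
instance ..
end

instance "fun" :: (type, real_vector) real_vector
  by standard (auto simp: scaleR_fun_def fun_eq_iff algebra_simps)

section \<open>Smooth manifolds\<close>

text \<open>\<open>C\<^sup>k\<close> maps on an open set, by iterated directional derivatives.\<close>

fun Ck_on :: "nat \<Rightarrow> 'e::real_normed_vector set \<Rightarrow> ('e \<Rightarrow> 'b::real_normed_vector) \<Rightarrow> bool" where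
  "Ck_on 0 S f \<longleftrightarrow> continuous_on S f"
| "Ck_on (Suc k) S f \<longleftrightarrow>
     (\<forall>x\<in>S. f differentiable at x) \<and> (\<forall>v. Ck_on k S (\<lambda>x. frechet_derivative f (at x) v))"

definition smooth_on :: "'e::real_normed_vector set \<Rightarrow> ('e \<Rightarrow> 'b::real_normed_vector) \<Rightarrow> bool"
  where "smooth_on S f \<longleftrightarrow> (\<forall>k. Ck_on k S f)"

text \<open>A chart is a pair of its domain and its coordinate map. The model space \<open>'e\<close>, a real inner
  product space of finite dimension, plays the role of \<open>\<real>\<^sup>n\<close>; the class \<open>euclidean_space\<close>
  would exclude dimension zero. The underlying space of the manifold is the whole type \<open>'a\<close>.\<close>

type_synonym ('a, 'e) chart = "'a set \<times> ('a \<Rightarrow> 'e)"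

definition smooth_manifold ::
    "('a::{t2_space, second_countable_topology}, 'e::real_inner) chart set \<Rightarrow> bool" where
  "smooth_manifold A \<longleftrightarrow>
     (\<exists>B::'e set. finite B \<and> span B = UNIV) \<and>
     (\<Union>(U, \<phi>)\<in>A. U) = UNIV \<and>
     (\<forall>(U, \<phi>)\<in>A. open U \<and> open (\<phi> ` U) \<and> homeomorphism U (\<phi> ` U) \<phi> (inv_into U \<phi>)) \<and>
     (\<forall>(U, \<phi>)\<in>A. \<forall>(V, \<psi>)\<in>A. smooth_on (\<phi> ` (U \<inter> V)) (\<psi> \<circ> inv_into U \<phi>))"

definition smooth_functions :: "('a, 'e::real_normed_vector) chart set \<Rightarrow> ('a \<Rightarrow> real) set" where
  "smooth_functions A = {f. \<forall>(U, \<phi>)\<in>A. smooth_on (\<phi> ` U) (f \<circ> inv_into U \<phi>)}"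

section \<open>Tangent vectors and vector fields\<close>

type_synonym 'a tvec = "('a \<Rightarrow> real) \<Rightarrow> real"
type_synonym 'a vfield = "'a \<Rightarrow> 'a tvec"

text \<open>Tangent vectors at \<open>x\<close> are the derivations at \<open>x\<close> of the algebra of smooth functions. The
  value \<open>0\<close> on non-smooth functions makes each derivation a unique HOL function.\<close>

definition tangent_space :: "('a, 'e::real_normed_vector) chart set \<Rightarrow> 'a \<Rightarrow> 'a tvec set" where
  "tangent_space A x = {v.
     (\<forall>f\<in>smooth_functions A. \<forall>h\<in>smooth_functions A. v (\<lambda>y. f y + h y) = v f + v h) \<and>
     (\<forall>c. \<forall>f\<in>smooth_functions A. v (\<lambda>y. c * f y) = c * v f) \<and>
     (\<forall>f\<in>smooth_functions A. \<forall>h\<in>smooth_functions A. v (\<lambda>y. f y * h y) = f x * v h + h x * v f) \<and>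
     (\<forall>f. f \<notin> smooth_functions A \<longrightarrow> v f = 0)}"

definition vector_fields :: "('a, 'e::real_normed_vector) chart set \<Rightarrow> 'a vfield set" where
  "vector_fields A = {X. (\<forall>x. X x \<in> tangent_space A x) \<and>
     (\<forall>f\<in>smooth_functions A. (\<lambda>x. X x f) \<in> smooth_functions A)}"

definition lie_bracket :: "'a vfield \<Rightarrow> 'a vfield \<Rightarrow> 'a vfield" where
  "lie_bracket X Y = (\<lambda>x f. X x (\<lambda>y. Y y f) - Y x (\<lambda>y. X y f))"

section \<open>Tensor fields\<close>

text \<open>A tensor field is a family of multilinear maps on the tangent spaces that takes smooth vector
  fields to a smooth function or vector field. Its values outside the tangent spaces are irrelevant.\<close>

definition linear_on_tangent ::
    "('a, 'e::real_normed_vector) chart set \<Rightarrow> 'a \<Rightarrow> ('a tvec \<Rightarrow> 'b::real_vector) \<Rightarrow> bool" where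
  "linear_on_tangent A x L \<longleftrightarrow>
     (\<forall>u\<in>tangent_space A x. \<forall>v\<in>tangent_space A x. L (u + v) = L u + L v) \<and>
     (\<forall>c. \<forall>v\<in>tangent_space A x. L (c *\<^sub>R v) = c *\<^sub>R L v)"

definition one_form ::
    "('a, 'e::real_normed_vector) chart set \<Rightarrow> ('a \<Rightarrow> 'a tvec \<Rightarrow> real) \<Rightarrow> bool" where
  "one_form A \<tau> \<longleftrightarrow>
     (\<forall>x. linear_on_tangent A x (\<tau> x)) \<and>
     (\<forall>X\<in>vector_fields A. (\<lambda>x. \<tau> x (X x)) \<in> smooth_functions A)"

definition tensor_0_2 ::
    "('a, 'e::real_normed_vector) chart set \<Rightarrow> ('a \<Rightarrow> 'a tvec \<Rightarrow> 'a tvec \<Rightarrow> real) \<Rightarrow> bool" where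
  "tensor_0_2 A g \<longleftrightarrow>
     (\<forall>x. \<forall>u\<in>tangent_space A x.
        linear_on_tangent A x (\<lambda>v. g x u v) \<and> linear_on_tangent A x (\<lambda>v. g x v u)) \<and>
     (\<forall>X\<in>vector_fields A. \<forall>Y\<in>vector_fields A. (\<lambda>x. g x (X x) (Y x)) \<in> smooth_functions A)"

definition tensor_0_3 ::
    "('a, 'e::real_normed_vector) chart set \<Rightarrow> ('a \<Rightarrow> 'a tvec \<Rightarrow> 'a tvec \<Rightarrow> 'a tvec \<Rightarrow> real) \<Rightarrow> bool"
  where
  "tensor_0_3 A Q \<longleftrightarrow>
     (\<forall>x. \<forall>u\<in>tangent_space A x. \<forall>w\<in>tangent_space A x.
        linear_on_tangent A x (\<lambda>v. Q x v u w) \<and>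
        linear_on_tangent A x (\<lambda>v. Q x u v w) \<and>
        linear_on_tangent A x (\<lambda>v. Q x u w v)) \<and>
     (\<forall>X\<in>vector_fields A. \<forall>Y\<in>vector_fields A. \<forall>Z\<in>vector_fields A.
        (\<lambda>x. Q x (X x) (Y x) (Z x)) \<in> smooth_functions A)"

definition tensor_1_2 ::
    "('a, 'e::real_normed_vector) chart set \<Rightarrow> ('a \<Rightarrow> 'a tvec \<Rightarrow> 'a tvec \<Rightarrow> 'a tvec) \<Rightarrow> bool" where
  "tensor_1_2 A T \<longleftrightarrow>
     (\<forall>x. \<forall>u\<in>tangent_space A x.
        linear_on_tangent A x (\<lambda>v. T x u v) \<and> linear_on_tangent A x (\<lambda>v. T x v u)) \<and>
     (\<forall>X\<in>vector_fields A. \<forall>Y\<in>vector_fields A. (\<lambda>x. T x (X x) (Y x)) \<in> vector_fields A)"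

definition torsion_tensor ::
    "('a, 'e::real_normed_vector) chart set \<Rightarrow> ('a \<Rightarrow> 'a tvec \<Rightarrow> 'a tvec \<Rightarrow> 'a tvec) \<Rightarrow> bool" where
  "torsion_tensor A T \<longleftrightarrow> tensor_1_2 A T \<and>
     (\<forall>x. \<forall>u\<in>tangent_space A x. \<forall>v\<in>tangent_space A x. T x u v = - T x v u)"

definition non_metricity_tensor ::
    "('a, 'e::real_normed_vector) chart set \<Rightarrow> ('a \<Rightarrow> 'a tvec \<Rightarrow> 'a tvec \<Rightarrow> 'a tvec \<Rightarrow> real) \<Rightarrow> bool"
  where
  "non_metricity_tensor A Q \<longleftrightarrow> tensor_0_3 A Q \<and>
     (\<forall>x. \<forall>w\<in>tangent_space A x. \<forall>u\<in>tangent_space A x. \<forall>v\<in>tangent_space A x.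
        Q x w u v = Q x w v u)"

definition ext_deriv :: "('a \<Rightarrow> 'a tvec \<Rightarrow> real) \<Rightarrow> 'a vfield \<Rightarrow> 'a vfield \<Rightarrow> 'a \<Rightarrow> real" where
  "ext_deriv \<tau> X Y = (\<lambda>x.
     X x (\<lambda>y. \<tau> y (Y y)) - Y x (\<lambda>y. \<tau> y (X y)) - \<tau> x (lie_bracket X Y x))"

definition lie_deriv ::
    "'a vfield \<Rightarrow> ('a \<Rightarrow> 'a tvec \<Rightarrow> 'a tvec \<Rightarrow> real) \<Rightarrow> 'a vfield \<Rightarrow> 'a vfield \<Rightarrow> 'a \<Rightarrow> real" where
  "lie_deriv \<xi> g X Y = (\<lambda>x.
     \<xi> x (\<lambda>y. g y (X y) (Y y)) - g x (lie_bracket \<xi> X x) (Y x) - g x (X x) (lie_bracket \<xi> Y x))"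

section \<open>Light-like manifolds\<close>

definition radical ::
    "('a, 'e::real_normed_vector) chart set \<Rightarrow> ('a \<Rightarrow> 'a tvec \<Rightarrow> 'a tvec \<Rightarrow> real) \<Rightarrow> 'a \<Rightarrow> 'a tvec set"
  where
  "radical A g x = {v \<in> tangent_space A x. \<forall>w\<in>tangent_space A x. g x v w = 0}"

text \<open>The index of a symmetric bilinear form is the largest dimension of a subspace on which the
  form is negative definite.\<close>

definition index_at ::
    "('a, 'e::real_normed_vector) chart set \<Rightarrow> ('a \<Rightarrow> 'a tvec \<Rightarrow> 'a tvec \<Rightarrow> real) \<Rightarrow> 'a \<Rightarrow> nat" where
  "index_at A g x = Max {dim W | W. subspace W \<and> W \<subseteq> tangent_space A x \<and>
     (\<forall>v\<in>W. v \<noteq> 0 \<longrightarrow> g x v v < 0)}"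

definition lightlike_manifold ::
    "('a::{t2_space, second_countable_topology}, 'e::real_inner) chart set \<Rightarrow>
     ('a \<Rightarrow> 'a tvec \<Rightarrow> 'a tvec \<Rightarrow> real) \<Rightarrow> nat \<Rightarrow> nat \<Rightarrow> bool" where
  "lightlike_manifold A g q r \<longleftrightarrow>
     smooth_manifold A \<and> tensor_0_2 A g \<and>
     (\<forall>x. \<forall>u\<in>tangent_space A x. \<forall>v\<in>tangent_space A x. g x u v = g x v u) \<and>
     (\<forall>x. index_at A g x = q) \<and> (\<forall>x. dim (radical A g x) = r)"

definition radical_sections ::
    "('a, 'e::real_normed_vector) chart set \<Rightarrow> ('a \<Rightarrow> 'a tvec \<Rightarrow> 'a tvec \<Rightarrow> real) \<Rightarrow> 'a vfield set"
  where
  "radical_sections A g = {X \<in> vector_fields A. \<forall>x. X x \<in> radical A g x}"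

section \<open>Linear connections\<close>

text \<open>Membership in the extensional function space fixes the value of a connection outside the
  smooth vector fields, so that equality of connections is equality of HOL functions.\<close>

definition linear_connection ::
    "('a, 'e::real_normed_vector) chart set \<Rightarrow> ('a vfield \<Rightarrow> 'a vfield \<Rightarrow> 'a vfield) \<Rightarrow> bool" where
  "linear_connection A nab \<longleftrightarrow>
     nab \<in> vector_fields A \<rightarrow>\<^sub>E (vector_fields A \<rightarrow>\<^sub>E vector_fields A) \<and>
     (\<forall>X\<in>vector_fields A. \<forall>Y\<in>vector_fields A. \<forall>Z\<in>vector_fields A.
        nab (X + Y) Z = nab X Z + nab Y Z \<and> nab Z (X + Y) = nab Z X + nab Z Y) \<and>
     (\<forall>c. \<forall>X\<in>vector_fields A. \<forall>Y\<in>vector_fields A. nab X (c *\<^sub>R Y) = c *\<^sub>R nab X Y) \<and>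
     (\<forall>f\<in>smooth_functions A. \<forall>X\<in>vector_fields A. \<forall>Y\<in>vector_fields A.
        nab (\<lambda>x. f x *\<^sub>R X x) Y = (\<lambda>x. f x *\<^sub>R nab X Y x) \<and>
        nab X (\<lambda>x. f x *\<^sub>R Y x) = (\<lambda>x. X x f *\<^sub>R Y x + f x *\<^sub>R nab X Y x))"

definition torsion ::
    "('a vfield \<Rightarrow> 'a vfield \<Rightarrow> 'a vfield) \<Rightarrow> 'a vfield \<Rightarrow> 'a vfield \<Rightarrow> 'a vfield" where
  "torsion nab X Y = nab X Y - nab Y X - lie_bracket X Y"

definition cov_deriv_metric ::
    "('a vfield \<Rightarrow> 'a vfield \<Rightarrow> 'a vfield) \<Rightarrow> ('a \<Rightarrow> 'a tvec \<Rightarrow> 'a tvec \<Rightarrow> real) \<Rightarrow>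
     'a vfield \<Rightarrow> 'a vfield \<Rightarrow> 'a vfield \<Rightarrow> 'a \<Rightarrow> real" where
  "cov_deriv_metric nab g Z X Y = (\<lambda>x.
     Z x (\<lambda>y. g y (X y) (Y y)) - g x (nab Z X x) (Y x) - g x (X x) (nab Z Y x))"

definition cov_deriv_form ::
    "('a vfield \<Rightarrow> 'a vfield \<Rightarrow> 'a vfield) \<Rightarrow> ('a \<Rightarrow> 'a tvec \<Rightarrow> real) \<Rightarrow>
     'a vfield \<Rightarrow> 'a vfield \<Rightarrow> 'a \<Rightarrow> real" where
  "cov_deriv_form nab \<tau> X Y = (\<lambda>x. X x (\<lambda>y. \<tau> y (Y y)) - \<tau> x (nab X Y x))"

end

theory Submission
  imports Defs
begin

text \<open>The degenerate form \<open>g\<close> is repaired: put \<open>h = g + \<tau>\<^sub>1 \<otimes> \<tau>\<^sub>1 + \<dots> + \<tau>\<^sub>r \<otimes> \<tau>\<^sub>r\<close>. Since \<open>g\<close>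
  vanishes on \<open>\<xi>\<^sub>i\<close>, duality gives \<open>h(v, \<xi>\<^sub>i) = \<tau>\<^sub>i(v)\<close>. A vector \<open>v\<close> that is \<open>h\<close>-orthogonal to all
  vectors is therefore annihilated by every \<open>\<tau>\<^sub>i\<close>, so it lies in the radical of \<open>g\<close>. By a dimension
  count the radical is spanned by the \<open>\<xi>\<^sub>i\<close>, and a combination of the \<open>\<xi>\<^sub>i\<close> annihilated by every
  \<open>\<tau>\<^sub>i\<close> is zero. Hence \<open>h\<close> is nondegenerate (\<open>completed_form_nondegenerate\<close>).

  For a nondegenerate symmetric form, every torsion \<open>T\<close> and every non-metricity \<open>Q\<close> belong to exactly
  one connection. The three permuted non-metricity equations and the three torsion equations can be
  solved for \<open>2 h(\<nabla>\<^sub>X Y, Z)\<close> (\<open>koszul_formula\<close>), which gives uniqueness. Conversely the expression so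
  obtained, \<open>koszul_form X Y Z\<close>, is linear over the smooth functions in \<open>Z\<close>, so it is represented by a
  vector field (\<open>form_represents\<close>), and this field is taken as \<open>\<nabla>\<^sub>X Y\<close>.

  If the \<open>\<tau>\<^sub>i\<close> are parallel, \<open>\<nabla>g\<close> and \<open>\<nabla>h\<close> agree (\<open>cov_deriv_metric_completed_form\<close>), so a connection
  as in the theorem is the connection of \<open>h\<close>, \<open>T\<close> and \<open>Q\<close>. It remains to see that the \<open>\<tau>\<^sub>i\<close> are parallel
  for that connection, and here the two compatibility conditions enter. The condition on \<open>d\<tau>\<^sub>j\<close> says
  \<open>L\<^sub>\<xi> \<tau>\<^sub>j = \<tau>\<^sub>j(T(\<xi>, \<cdot>))\<close> for \<open>\<xi> = \<xi>\<^sub>i\<close>. So the condition on \<open>L\<^sub>\<xi> g\<close> carries over from \<open>g\<close> to \<open>h\<close>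
  (\<open>lie_deriv_completed_form\<close>). With \<open>Z = \<xi>\<^sub>i\<close> it cancels most of the Koszul expression; what is left
  is \<open>2 X(\<tau>\<^sub>i(Y))\<close> by the condition on \<open>d\<tau>\<^sub>i\<close>. That is, \<open>\<tau>\<^sub>i(\<nabla>\<^sub>X Y) = X(\<tau>\<^sub>i(Y))\<close>.

  The analytic part supplies what these arguments take for granted: tangent vectors, which are
  derivations of the algebra of global smooth functions, form a finite-dimensional space and extend to
  smooth vector fields, and a linear functional on fields is represented by a smooth field. All of it
  is reduced to global objects. Hadamard's lemma, multiplied by a bump function, shows that for each
  point there are global fields \<open>E\<^sub>i\<close> and a global function \<open>d\<close>, nonzero at that point, such
  that \<open>d Z\<close> is a combination of the \<open>E\<^sub>i\<close> with global smooth coefficients for every field \<open>Z\<close>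
  (\<open>local_frame_exists\<close>). Gaussian elimination solves linear systems by quotients of
  global smooth functions (\<open>smooth_linear_system\<close>), and functions that are locally such quotients are
  smooth (\<open>smooth_function_local_quotient\<close>).\<close>

section \<open>Calculus of \<open>C\<^sup>k\<close> functions\<close>

lemma Ck_on_cong:
  assumes "open S" "\<And>x. x \<in> S \<Longrightarrow> f x = g x" "Ck_on k S f"
  shows "Ck_on k S g"
  using assms(2,3)
proof (induction k arbitrary: f g)
  case 0
  then show ?case by (simp cong: continuous_on_cong)
next
  case (Suc k)
  have d: "(g has_derivative frechet_derivative f (at x)) (at x)" if "x \<in> S" for x
  proof -
    have "(f has_derivative frechet_derivative f (at x)) (at x)"
      using Suc.prems(2) that by (simp add: frechet_derivative_works)
    then show ?thesis
      using has_derivative_transform_within_open[OF _ assms(1) that] Suc.prems(1) by blast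
  qed
  have "Ck_on k S (\<lambda>x. frechet_derivative g (at x) v)" for v
  proof (rule Suc.IH)
    show "Ck_on k S (\<lambda>x. frechet_derivative f (at x) v)" using Suc.prems(2) by simp
    show "frechet_derivative f (at x) v = frechet_derivative g (at x) v" if "x \<in> S" for x
      using frechet_derivative_at[OF d[OF that]] by simp
  qed
  then show ?case using d by (auto simp: differentiable_def)
qed

lemma Ck_on_SucI:
  assumes "open S" "\<And>x. x \<in> S \<Longrightarrow> (f has_derivative D x) (at x)" "\<And>v. Ck_on k S (\<lambda>x. D x v)"
  shows "Ck_on (Suc k) S f"
proof -
  have "Ck_on k S (\<lambda>x. frechet_derivative f (at x) v)" for v
    by (rule Ck_on_cong[OF assms(1) _ assms(3)[of v]])
       (use frechet_derivative_at[OF assms(2)] in simp)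
  then show ?thesis using assms(2) by (auto simp: differentiable_def)
qed

lemma Ck_on_SucD:
  assumes "Ck_on (Suc k) S f"
  shows "x \<in> S \<Longrightarrow> (f has_derivative frechet_derivative f (at x)) (at x)"
    and "Ck_on k S (\<lambda>x. frechet_derivative f (at x) v)"
  using assms by (auto simp: frechet_derivative_works)

lemma Ck_on_subset: "Ck_on k S f \<Longrightarrow> T \<subseteq> S \<Longrightarrow> Ck_on k T f"
  by (induction k arbitrary: f) (auto intro: continuous_on_subset)

lemma Ck_on_pred: "Ck_on (Suc k) S f \<Longrightarrow> Ck_on k S f"
proof (induction k arbitrary: f)
  case 0
  then show ?case
    by (auto intro!: continuous_at_imp_continuous_on differentiable_imp_continuous_within)
next
  case (Suc k)
  then show ?case by (meson Ck_on.simps(2))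
qed

lemma Ck_on_const: "open S \<Longrightarrow> Ck_on k S (\<lambda>x. c)"
proof (induction k arbitrary: c)
  case (Suc k)
  show ?case by (rule Ck_on_SucI[where D = "\<lambda>_ _. 0"]) (use Suc in auto)
qed simp

lemma Ck_on_linear:
  assumes "bounded_linear l" "open S"
  shows "Ck_on k S l"
proof (cases k)
  case 0
  then show ?thesis using assms by (simp add: linear_continuous_on)
next
  case (Suc m)
  show ?thesis unfolding Suc
    by (rule Ck_on_SucI[OF assms(2) bounded_linear_imp_has_derivative[OF assms(1)]])
       (rule Ck_on_const[OF assms(2)])
qed

lemma Ck_on_add:
  "open S \<Longrightarrow> Ck_on k S f \<Longrightarrow> Ck_on k S g \<Longrightarrow> Ck_on k S (\<lambda>x. f x + g x)"
proof (induction k arbitrary: f g)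
  case 0
  then show ?case by (simp add: continuous_on_add)
next
  case (Suc k)
  show ?case
    by (rule Ck_on_SucI[OF Suc.prems(1)
          has_derivative_add[OF Ck_on_SucD(1)[OF Suc.prems(2)] Ck_on_SucD(1)[OF Suc.prems(3)]]])
       (use Suc in auto)
qed

lemma Ck_on_mult:
  fixes f g :: "'e::real_normed_vector \<Rightarrow> real"
  shows "open S \<Longrightarrow> Ck_on k S f \<Longrightarrow> Ck_on k S g \<Longrightarrow> Ck_on k S (\<lambda>x. f x * g x)"
proof (induction k arbitrary: f g)
  case 0
  then show ?case by (simp add: continuous_on_mult)
next
  case (Suc k)
  show ?case
    by (rule Ck_on_SucI[OF Suc.prems(1)
          has_derivative_mult[OF Ck_on_SucD(1)[OF Suc.prems(2)] Ck_on_SucD(1)[OF Suc.prems(3)]]])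
       (assumption | intro Ck_on_add Suc.IH Suc.prems(1) Ck_on_pred[OF Suc.prems(2)]
          Ck_on_pred[OF Suc.prems(3)] Ck_on_SucD(2)[OF Suc.prems(2)] Ck_on_SucD(2)[OF Suc.prems(3)])+
qed

lemma Ck_on_sum:
  "open S \<Longrightarrow> (\<And>i. i \<in> I \<Longrightarrow> Ck_on k S (f i)) \<Longrightarrow> Ck_on k S (\<lambda>x. \<Sum>i\<in>I. f i x)"
proof (induction I rule: infinite_finite_induct)
  case (insert i I)
  then show ?case by (simp add: Ck_on_add)
qed (simp_all add: Ck_on_const)

lemma Ck_on_linear_comp:
  assumes "bounded_linear l" "open S" "Ck_on k S f"
  shows "Ck_on k S (\<lambda>x. l (f x))"
  using assms(3)
proof (induction k arbitrary: f)
  case 0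
  then show ?case using assms by (simp add: bounded_linear.continuous_on)
next
  case (Suc k)
  show ?case
    by (rule Ck_on_SucI[OF assms(2)
          bounded_linear.has_derivative[OF assms(1) Ck_on_SucD(1)[OF Suc.prems]]])
       (use Suc in auto)
qed

lemma Ck_on_local:
  assumes "\<And>x. x \<in> S \<Longrightarrow> \<exists>O'. open O' \<and> x \<in> O' \<and> Ck_on k (O' \<inter> S) f" "open S"
  shows "Ck_on k S f"
  using assms(1)
proof (induction k arbitrary: f)
  case 0
  show ?case unfolding Ck_on.simps
  proof (intro continuous_at_imp_continuous_on ballI)
    fix x assume x: "x \<in> S"
    then obtain O' where "open O'" "x \<in> O'" "continuous_on (O' \<inter> S) f"
      using 0 by auto
    then show "isCont f x" using x assms(2) continuous_on_eq_continuous_at[of "O' \<inter> S" f]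
      by auto
  qed
next
  case (Suc k)
  have "f differentiable at x" if "x \<in> S" for x
    using Suc.prems[OF that] that by auto
  moreover have "Ck_on k S (\<lambda>x. frechet_derivative f (at x) v)" for v
    by (rule Suc.IH) (use Suc.prems in \<open>metis Ck_on.simps(2)\<close>)
  ultimately show ?case by simp
qed

text \<open>The basis is indexed by numbers because linear systems in its coordinates are later solved by
  induction on their size.\<close>

definition orthonormal_frame :: "nat \<Rightarrow> (nat \<Rightarrow> 'e::real_inner) \<Rightarrow> bool" where
  "orthonormal_frame n b \<longleftrightarrow> (\<forall>i<n. \<forall>j<n. b i \<bullet> b j = (if i = j then 1 else 0)) \<and>
     (\<forall>y. y = (\<Sum>i<n. (y \<bullet> b i) *\<^sub>R b i))"

lemma orthonormal_frame_inner:
  "orthonormal_frame n b \<Longrightarrow> i < n \<Longrightarrow> j < n \<Longrightarrow> b i \<bullet> b j = (if i = j then 1 else 0)"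
  by (auto simp: orthonormal_frame_def)

lemma orthonormal_frame_expand: "orthonormal_frame n b \<Longrightarrow> (\<Sum>i<n. (y \<bullet> b i) *\<^sub>R b i) = y"
  unfolding orthonormal_frame_def by metis

lemma linear_orthonormal_frame:
  assumes "orthonormal_frame n b" "linear l"
  shows "l v = (\<Sum>i<n. (v \<bullet> b i) *\<^sub>R l (b i))"
proof -
  have "l v = l (\<Sum>i<n. (v \<bullet> b i) *\<^sub>R b i)"
    by (simp add: orthonormal_frame_expand[OF assms(1)])
  also have "\<dots> = (\<Sum>i<n. (v \<bullet> b i) *\<^sub>R l (b i))"
    using assms(2) by (simp add: linear_sum linear_cmul)
  finally show ?thesis .
qed

lemma orthonormal_frame_exists:
  fixes B :: "'e::real_inner set"
  assumes "finite B" "span B = UNIV"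
  obtains n and b :: "nat \<Rightarrow> 'e" where "orthonormal_frame n b"
proof -
  obtain C where C: "finite C" "span C = (UNIV :: 'e set)" "pairwise orthogonal C"
    using basis_orthogonal[OF assms(1)] assms(2) by metis
  let ?C = "C - {0}"
  obtain e where e: "bij_betw e {..<card ?C} ?C"
    using ex_bij_betw_nat_finite[of ?C] C(1) by (auto simp: atLeast0LessThan)
  define b where "b i = e i /\<^sub>R norm (e i)" for i
  have eC: "e i \<in> C" "e i \<noteq> 0" if "i < card ?C" for i
    using bij_betwE[OF e] that by auto
  have orth: "b i \<bullet> b j = (if i = j then 1 else 0)" if ij: "i < card ?C" "j < card ?C" for i j
  proof (cases "i = j")
    case True
    then show ?thesis using eC[OF ij(1)] by (simp add: b_def dot_square_norm power2_eq_square)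
  next
    case False
    then have "e i \<noteq> e j" using e ij by (auto simp: bij_betw_def inj_on_def)
    then have "e i \<bullet> e j = 0" using C(3) eC ij by (auto simp: pairwise_def orthogonal_def)
    then show ?thesis using False by (simp add: b_def)
  qed
  have expand: "y = (\<Sum>i<card ?C. (y \<bullet> b i) *\<^sub>R b i)" for y
  proof -
    have "y \<in> span C" using C(2) by simp
    then show ?thesis
    proof (induction rule: span_induct_alt)
      case base
      then show ?case by simp
    next
      case (step c x y)
      have "x = (\<Sum>i<card ?C. (x \<bullet> b i) *\<^sub>R b i)"
      proof (cases "x = 0")
        case False
        then obtain i where i: "i < card ?C" "x = e i"
          using step.hyps bij_betw_imp_surj_on[OF e] by (auto simp: image_iff set_eq_iff)
        have x: "x = norm x *\<^sub>R b i" using i eC by (simp add: b_def)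
        have "(\<Sum>j<card ?C. (x \<bullet> b j) *\<^sub>R b j) = (\<Sum>j<card ?C. if j = i then norm x *\<^sub>R b j else 0)"
          by (subst (1) x, rule sum.cong) (use orth i(1) in auto)
        also have "\<dots> = x" using i(1) x by simp
        finally show ?thesis by simp
      qed simp
      moreover have "(\<Sum>i<card ?C. ((c *\<^sub>R x + y) \<bullet> b i) *\<^sub>R b i) =
          c *\<^sub>R (\<Sum>i<card ?C. (x \<bullet> b i) *\<^sub>R b i) + (\<Sum>i<card ?C. (y \<bullet> b i) *\<^sub>R b i)"
        by (simp add: inner_add_left scaleR_add_left sum.distrib scaleR_sum_right)
      ultimately show ?case using step.IH by simp
    qed
  qed
  show ?thesis using that[of "card ?C" b] orth expand unfolding orthonormal_frame_def by blast
qed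

text \<open>The model space is finite-dimensional only by assumption, not by its type class, so the Heine-Borel
  property is derived here: the ball is a closed subset of a cube, and a cube is a sum of
  compact segments.\<close>

lemma compact_cball_orthonormal_frame:
  assumes "orthonormal_frame n (b :: nat \<Rightarrow> 'e::real_inner)"
  shows "compact (cball (c :: 'e::real_inner) R)"
proof -
  have cube: "compact ((\<lambda>a. \<Sum>i<m. a i *\<^sub>R b i) ` {a. \<forall>i<m. \<bar>a i\<bar> \<le> R})" (is "compact (?K m)") for m
  proof (induction m)
    case 0
    show ?case by (rule finite_imp_compact) (simp add: image_constant_conv)
  next
    case (Suc m)
    have seg: "compact ((\<lambda>t. t *\<^sub>R b m) ` {-R..R})"
      by (intro compact_continuous_image continuous_intros) auto
    have "?K (Suc m) = {x + y |x y. x \<in> ?K m \<and> y \<in> (\<lambda>t. t *\<^sub>R b m) ` {-R..R}}"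
    proof safe
      fix a assume "\<forall>i<Suc m. \<bar>a i\<bar> \<le> R"
      then show "\<exists>x y. (\<Sum>i<Suc m. a i *\<^sub>R b i) = x + y \<and> x \<in> ?K m \<and> y \<in> (\<lambda>t. t *\<^sub>R b m) ` {-R..R}"
        by (intro exI[of _ "\<Sum>i<m. a i *\<^sub>R b i"] exI[of _ "a m *\<^sub>R b m"] conjI
            image_eqI[of _ _ a] image_eqI[of _ _ "a m"]) (auto simp: abs_le_iff)
    next
      fix a and t :: real assume "\<forall>i<m. \<bar>a i\<bar> \<le> R" "t \<in> {-R..R}"
      then show "(\<Sum>i<m. a i *\<^sub>R b i) + t *\<^sub>R b m \<in> ?K (Suc m)"
        by (intro image_eqI[of _ _ "a(m := t)"]) (auto simp: less_Suc_eq abs_le_iff)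
    qed
    then show ?case using compact_sums[OF Suc seg] by simp
  qed
  have "cball 0 R \<subseteq> ?K n"
  proof
    fix y :: 'e assume y: "y \<in> cball 0 R"
    have "\<bar>y \<bullet> b i\<bar> \<le> R" if "i < n" for i
    proof -
      have "norm (b i) = 1" using orthonormal_frame_inner[OF assms that that] by (simp add: norm_eq_1)
      then show ?thesis using Cauchy_Schwarz_ineq2[of y "b i"] y by simp
    qed
    then show "y \<in> ?K n"
      by (intro image_eqI[of _ _ "\<lambda>i. y \<bullet> b i"]) (simp_all add: orthonormal_frame_expand[OF assms])
  qed
  then have "compact (cball (0::'e) R)"
    using compact_Int_closed[OF cube[of n] closed_cball[of 0 R]] by (simp add: Int_absorb1)
  then have "compact ((+) c ` cball 0 R)" by (rule compact_translation)
  then show ?thesis by simp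
qed

text \<open>By the chain rule the derivative of the composition is a sum of products of derivatives of \<open>f\<close>
  with partial derivatives of \<open>F\<close> composed with \<open>f\<close>. The finite frame of the middle
  space is what turns the composition of two derivatives into such a sum, to which the induction
  hypothesis applies.\<close>

lemma Ck_on_compose:
  fixes F :: "'m::real_inner \<Rightarrow> real" and b :: "nat \<Rightarrow> 'm"
  assumes "orthonormal_frame n b" "open S" "open T" "f ` S \<subseteq> T"
  shows "Ck_on k S f \<Longrightarrow> Ck_on k T F \<Longrightarrow> Ck_on k S (\<lambda>x. F (f x))"
proof (induction k arbitrary: F)
  case 0
  then show ?case using assms continuous_on_compose2 by (auto simp: image_subset_iff)
next
  case (Suc k)
  have fT: "f x \<in> T" if "x \<in> S" for x using assms(4) that by auto
  have d: "((\<lambda>x. F (f x)) has_derivative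
      (\<lambda>v. \<Sum>i<n. (frechet_derivative f (at x) v \<bullet> b i) * frechet_derivative F (at (f x)) (b i))) (at x)"
    if x: "x \<in> S" for x
  proof -
    have F: "(F has_derivative frechet_derivative F (at (f x))) (at (f x))"
      by (rule Ck_on_SucD(1)[OF Suc.prems(2) fT[OF x]])
    have "((\<lambda>x. F (f x)) has_derivative
      (\<lambda>v. frechet_derivative F (at (f x)) (frechet_derivative f (at x) v))) (at x)"
      by (rule has_derivative_compose[OF Ck_on_SucD(1)[OF Suc.prems(1) x] F])
    moreover have "(\<lambda>v. frechet_derivative F (at (f x)) (frechet_derivative f (at x) v)) =
        (\<lambda>v. \<Sum>i<n. (frechet_derivative f (at x) v \<bullet> b i) * frechet_derivative F (at (f x)) (b i))"
      by (intro ext) (rule linear_orthonormal_frame[OF assms(1) has_derivative_linear[OF F],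
            unfolded real_scaleR_def])
    ultimately show ?thesis by (simp only:)
  qed
  show ?case
  proof (rule Ck_on_SucI[OF assms(2) d], assumption, intro Ck_on_sum Ck_on_mult)
    fix v i
    show "Ck_on k S (\<lambda>x. frechet_derivative f (at x) v \<bullet> b i)"
      by (rule Ck_on_linear_comp[OF bounded_linear_inner_left assms(2) Ck_on_SucD(2)[OF Suc.prems(1)]])
    show "Ck_on k S (\<lambda>x. frechet_derivative F (at (f x)) (b i))"
      using Suc.IH[OF Ck_on_pred[OF Suc.prems(1)] Ck_on_SucD(2)[OF Suc.prems(2)]] .
  qed (use assms(2) in auto)
qed

lemma orthonormal_frame_real: "orthonormal_frame 1 (\<lambda>_. 1 :: real)"
  by (simp add: orthonormal_frame_def)

lemma Ck_on_inverse_real: "Ck_on k (- {0}) (inverse :: real \<Rightarrow> real)"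
proof (induction k)
  case 0
  have "continuous_on (- {0::real}) inverse" by (intro continuous_intros) simp
  then show ?case by simp
next
  case (Suc k)
  show ?case
  proof (rule Ck_on_SucI)
    show "(inverse has_derivative (\<lambda>v. (-1 * v) * (inverse x * inverse x))) (at x)"
      if "x \<in> - {0}" for x :: real
      using that by (auto intro!: derivative_eq_intros)
    show "Ck_on k (- {0}) (\<lambda>x. (- 1 * v) * (inverse x * inverse x))" for v :: real
      by (intro Ck_on_mult Ck_on_const Suc) (simp_all add: open_Compl)
  qed (simp add: open_Compl)
qed

lemma Ck_on_compose_real:
  fixes f :: "'e::real_normed_vector \<Rightarrow> real" and F :: "real \<Rightarrow> real"
  assumes "open S" "open T" "f ` S \<subseteq> T" "Ck_on k S f" "Ck_on k T F"
  shows "Ck_on k S (\<lambda>x. F (f x))"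
  using Ck_on_compose[OF orthonormal_frame_real] assms by blast

lemma Ck_on_divide:
  fixes f g :: "'e::real_normed_vector \<Rightarrow> real"
  assumes "open S" "Ck_on k S f" "Ck_on k S g" "\<And>x. x \<in> S \<Longrightarrow> g x \<noteq> 0"
  shows "Ck_on k S (\<lambda>x. f x / g x)"
proof -
  have "Ck_on k S (\<lambda>x. inverse (g x))"
    by (rule Ck_on_compose_real[OF assms(1) _ _ assms(3) Ck_on_inverse_real]) (use assms(4) in auto)
  then show ?thesis using Ck_on_mult[OF assms(1,2)] by (simp add: divide_inverse)
qed

subsection \<open>A smooth bump function\<close>

text \<open>For \<open>m = 0\<close> this is the standard smooth function \<open>exp(-1/x)\<close> that is flat at zero. The family
  over \<open>m\<close> is closed under taking derivatives up to linear combinations, which gives smoothness by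
  induction.\<close>

definition flat :: "nat \<Rightarrow> real \<Rightarrow> real" where
  "flat m x = (if x \<le> 0 then 0 else exp (- inverse x) * inverse x ^ m)"

text \<open>At zero the difference quotient is \<open>flat (m + 1)\<close> on the right, and the exponential beats every
  power; elsewhere this is ordinary differentiation.\<close>

lemma flat_has_derivative:
  "(flat m has_field_derivative (flat (m + 2) x - real m * flat (m + 1) x)) (at x)"
proof -
  consider "x < 0" | "x = 0" | "x > 0" by linarith
  then show ?thesis
  proof cases
    case 1
    have "(flat m has_field_derivative 0) (at x)"
      by (rule has_field_derivative_transform_within_open[of "\<lambda>_. 0" _ _ "{..<0}"])
         (use 1 in \<open>auto simp: flat_def\<close>)
    then show ?thesis using 1 by (simp add: flat_def)
  next
    case 2
    have "((\<lambda>y. flat m y / y) \<longlongrightarrow> 0) (at_left 0)"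
      by (rule Lim_transform_eventually[OF tendsto_const])
         (auto simp: flat_def eventually_at_left_field intro!: exI[of _ "-1"])
    moreover have "((\<lambda>y. flat m y / y) \<longlongrightarrow> 0) (at_right 0)"
    proof (rule Lim_transform_eventually)
      show "((\<lambda>y::real. exp (- inverse y) * inverse y ^ (m + 1)) \<longlongrightarrow> 0) (at_right 0)"
        using filterlim_compose[OF tendsto_power_div_exp_0[of "m + 1"] filterlim_inverse_at_top_right]
        by (simp add: exp_minus divide_inverse mult.commute)
      show "\<forall>\<^sub>F y in at_right 0. exp (- inverse y) * inverse y ^ (m + 1) = flat m y / y"
        by (auto simp: flat_def eventually_at_right_field field_simps intro!: exI[of _ "1"])
    qed
    ultimately have "((\<lambda>y. flat m y / y) \<longlongrightarrow> 0) (at 0)"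
      by (simp add: filterlim_at_split)
    then show ?thesis using 2 by (simp add: has_field_derivative_iff flat_def)
  next
    case 3
    have "((\<lambda>x. exp (- inverse x) * inverse x ^ m) has_field_derivative
        exp (- inverse x) * (inverse x * inverse x) * inverse x ^ m
        + real m * - (inverse x * inverse x) * inverse x ^ (m - 1) * exp (- inverse x)) (at x)"
      by (rule DERIV_mult derivative_eq_intros refl | use 3 in simp)+
    moreover have "exp (- inverse x) * (inverse x * inverse x) * inverse x ^ m
        + real m * - (inverse x * inverse x) * inverse x ^ (m - 1) * exp (- inverse x)
        = flat (m + 2) x - real m * flat (m + 1) x"
      using 3 by (cases m) (simp_all add: flat_def algebra_simps)
    ultimately have "((\<lambda>x. exp (- inverse x) * inverse x ^ m) has_field_derivative
        (flat (m + 2) x - real m * flat (m + 1) x)) (at x)" by simp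
    then show ?thesis
      by (rule has_field_derivative_transform_within_open[of _ _ _ "{0<..}"])
         (use 3 in \<open>auto simp: flat_def\<close>)
  qed
qed

lemma Ck_on_flat: "Ck_on k UNIV (flat m)"
proof (induction k arbitrary: m)
  case 0
  have "isCont (flat m) x" for x using DERIV_isCont[OF flat_has_derivative] .
  then show ?case by (simp add: continuous_at_imp_continuous_on)
next
  case (Suc k)
  show ?case
  proof (rule Ck_on_SucI)
    show "(flat m has_derivative (\<lambda>v. (flat (m + 2) x + (- real m) * flat (m + 1) x) * v)) (at x)" for x
      using flat_has_derivative[of m x] by (simp add: has_field_derivative_def)
  qed (intro Ck_on_add Ck_on_mult Ck_on_const Suc open_UNIV)+
qed

definition bump :: "'e::real_inner \<Rightarrow> real \<Rightarrow> 'e \<Rightarrow> real" where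
  "bump c R y = flat 0 (R\<^sup>2 - (y - c) \<bullet> (y - c))"

lemma bump_eq_0: "y \<notin> cball c R \<Longrightarrow> R > 0 \<Longrightarrow> bump c R y = 0"
proof -
  assume "y \<notin> cball c R" "R > 0"
  then have "R\<^sup>2 \<le> (norm (y - c))\<^sup>2" by (intro power_mono) (auto simp: dist_norm norm_minus_commute)
  then show ?thesis by (simp add: bump_def flat_def dot_square_norm)
qed

lemma bump_nonzero_iff: "R > 0 \<Longrightarrow> bump c R y \<noteq> 0 \<longleftrightarrow> y \<in> ball c R"
proof -
  assume "R > 0"
  then have "(norm (y - c))\<^sup>2 < R\<^sup>2 \<longleftrightarrow> norm (y - c) < R"
    using power_mono_iff[of R "norm (y - c)" 2] by (auto simp: linorder_not_le[symmetric])
  then show ?thesis by (auto simp: bump_def flat_def dot_square_norm dist_norm norm_minus_commute)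
qed

lemma Ck_on_bump:
  assumes "orthonormal_frame n (b :: nat \<Rightarrow> 'e::real_inner)"
  shows "Ck_on k UNIV (bump (c :: 'e::real_inner) R)"
proof -
  have lin: "Ck_on k UNIV (\<lambda>y. (y - c) \<bullet> b i)" for i
  proof -
    have "Ck_on k UNIV (\<lambda>y. y \<bullet> b i + - (c \<bullet> b i))"
      by (intro Ck_on_add Ck_on_linear Ck_on_const bounded_linear_inner_left) auto
    then show ?thesis by (simp add: inner_diff_left)
  qed
  have eq: "R\<^sup>2 - (y - c) \<bullet> (y - c) = R\<^sup>2 + (-1) * (\<Sum>i<n. ((y - c) \<bullet> b i) * ((y - c) \<bullet> b i))" for y
  proof -
    have "(y - c) \<bullet> (y - c) = (y - c) \<bullet> (\<Sum>i<n. ((y - c) \<bullet> b i) *\<^sub>R b i)"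
      by (simp add: orthonormal_frame_expand[OF assms])
    then show ?thesis by (simp add: inner_sum_right)
  qed
  have "Ck_on k UNIV (\<lambda>y. flat 0 (R\<^sup>2 + (-1) * (\<Sum>i<n. ((y - c) \<bullet> b i) * ((y - c) \<bullet> b i))))"
    by (rule Ck_on_compose_real[OF _ _ _ _ Ck_on_flat])
       (intro Ck_on_add Ck_on_mult Ck_on_const Ck_on_sum lin open_UNIV subset_UNIV)+
  then show ?thesis unfolding bump_def[abs_def] eq .
qed

subsection \<open>Hadamard's lemma\<close>

text \<open>Differentiation under the integral sign holds on complete domains, and completeness is not part of the
  type class of the model space. The dual space \<open>'e \<Rightarrow>\<^sub>L real\<close> is complete
  as a type, and the frame makes the model space a linear retract of it: \<open>P\<close> below is a left inverse of the
  embedding \<open>v \<mapsto> (v \<bullet> _)\<close>. So the rule is applied to the integrand composed with \<open>P\<close>, and the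
  result is restricted along the embedding.\<close>

lemma leibniz_rule_orthonormal_frame:
  fixes f :: "'e::real_inner \<Rightarrow> real \<Rightarrow> real" and b :: "nat \<Rightarrow> 'e"
  assumes b: "orthonormal_frame n b" and S: "open S" "convex S"
    and f: "\<And>y t. y \<in> S \<Longrightarrow> t \<in> {0..1} \<Longrightarrow>
      ((\<lambda>y. f y t) has_derivative (\<lambda>v. \<Sum>i<n. (v \<bullet> b i) * f' i y t)) (at y)"
    and int: "\<And>y. y \<in> S \<Longrightarrow> f y integrable_on {0..1}"
    and cont: "\<And>i. i < n \<Longrightarrow> continuous_on (S \<times> {0..1}) (\<lambda>(y, t). f' i y t)"
    and y: "y \<in> S"
  shows "((\<lambda>y. integral {0..1} (f y)) has_derivative
    (\<lambda>v. \<Sum>i<n. (v \<bullet> b i) * integral {0..1} (f' i y))) (at y)"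
proof -
  define ev where "ev i = Blinfun (\<lambda>\<psi>::'e \<Rightarrow>\<^sub>L real. blinfun_apply \<psi> (b i))" for i
  have ev: "blinfun_apply (ev i) \<psi> = blinfun_apply \<psi> (b i)" for i \<psi>
    by (simp add: ev_def bounded_linear_Blinfun_apply blinfun.bounded_linear_left)
  define P where "P = (\<lambda>\<psi>::'e \<Rightarrow>\<^sub>L real. \<Sum>i<n. blinfun_apply \<psi> (b i) *\<^sub>R b i)"
  have blP: "bounded_linear P"
    unfolding P_def by (intro bounded_linear_sum bounded_linear_intros)
  have PJ: "P (blinfun_inner_left v) = v" for v
    using orthonormal_frame_expand[OF b, of v] by (simp add: P_def inner_commute)
  have inner_P: "P \<psi> \<bullet> b i = blinfun_apply \<psi> (b i)" if "i < n" for \<psi> i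
  proof -
    have "P \<psi> \<bullet> b i = (\<Sum>j<n. if j = i then blinfun_apply \<psi> (b j) else 0)"
      unfolding P_def inner_sum_left
      by (rule sum.cong) (use orthonormal_frame_inner[OF b] that in auto)
    then show ?thesis using that by simp
  qed
  define fx where "fx \<psi> t = (\<Sum>i<n. f' i (P \<psi>) t *\<^sub>R ev i)" for \<psi> t
  have cP: "continuous_on X P" for X by (rule linear_continuous_on[OF blP])
  have cf': "continuous_on (P -` S \<times> cbox 0 1) (\<lambda>x. f' i (P (fst x)) (snd x))" if "i < n" for i
  proof -
    have "continuous_on (P -` S \<times> cbox 0 1) (\<lambda>x. (P (fst x), snd x))"
      by (intro continuous_intros continuous_on_compose2[OF cP[of UNIV]]) auto
    note continuous_on_compose2[OF cont[OF that] this]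
    moreover have "(\<lambda>x. (P (fst x), snd x)) ` (P -` S \<times> cbox 0 1) \<subseteq> S \<times> {0..1::real}"
      by auto
    ultimately show ?thesis by (simp add: case_prod_unfold)
  qed
  have J: "y = P (blinfun_inner_left y)" by (simp add: PJ)
  have within: "((\<lambda>\<psi>. integral (cbox 0 1) (f (P \<psi>))) has_derivative integral (cbox 0 1) (fx (blinfun_inner_left y)))
      (at (blinfun_inner_left y) within P -` S)"
  proof (rule leibniz_rule)
    fix \<psi> and t :: real assume a: "\<psi> \<in> P -` S" "t \<in> cbox 0 1"
    have "((\<lambda>\<psi>. f (P \<psi>) t) has_derivative (\<lambda>v. \<Sum>i<n. (P v \<bullet> b i) * f' i (P \<psi>) t)) (at \<psi>)"
      using has_derivative_compose[OF bounded_linear_imp_has_derivative[OF blP] f] a by auto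
    moreover have "(\<lambda>v. \<Sum>i<n. (P v \<bullet> b i) * f' i (P \<psi>) t) = blinfun_apply (fx \<psi> t)"
      by (auto simp: fx_def blinfun.sum_left blinfun.scaleR_left ev inner_P fun_eq_iff mult.commute
          intro!: sum.cong)
    ultimately show "((\<lambda>\<psi>. f (P \<psi>) t) has_derivative blinfun_apply (fx \<psi> t)) (at \<psi> within P -` S)"
      using has_derivative_at_withinI by force
  next
    show "continuous_on (P -` S \<times> cbox 0 1) (\<lambda>(\<psi>, t). fx \<psi> t)"
      unfolding fx_def case_prod_unfold by (intro continuous_intros cf') auto
    show "convex (P -` S)"
      using S(2) convex_linear_vimage bounded_linear.linear[OF blP] by blast
    show "blinfun_inner_left y \<in> P -` S" using y by (simp add: PJ)
  qed (use int in auto)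
  have "open (P -` S)" using cP[of UNIV] S(1) by (simp add: continuous_on_open_vimage)
  then have "at (blinfun_inner_left y) within P -` S = at (blinfun_inner_left y)"
    by (rule at_within_open[rotated]) (simp add: PJ y)
  note D = within[unfolded this box_real]
  have "((\<lambda>y. integral {0..1} (f (P (blinfun_inner_left y)))) has_derivative
      (\<lambda>v. integral {0..1} (fx (blinfun_inner_left y)) (blinfun_inner_left v))) (at y)"
    by (rule has_derivative_compose[OF bounded_linear_imp_has_derivative[OF bounded_linear_blinfun_inner_left] D])
  moreover have "blinfun_apply (integral {0..1} (fx (blinfun_inner_left y))) (blinfun_inner_left v) =
      (\<Sum>i<n. (v \<bullet> b i) * integral {0..1} (f' i y))" for v
  proof -
    have ci: "continuous_on {0..1} (f' i y)" if "i < n" for i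
    proof -
      have "continuous_on {0..1} (\<lambda>t::real. (y, t))" by (intro continuous_intros)
      note continuous_on_compose2[OF cont[OF that] this]
      moreover have "(\<lambda>t. (y, t)) ` {0..1} \<subseteq> S \<times> {0..1::real}" using y by auto
      ultimately show ?thesis by (simp add: case_prod_unfold)
    qed
    have cfx: "continuous_on {0..1} (fx (blinfun_inner_left y))"
      unfolding fx_def PJ by (intro continuous_intros ci) auto
    have "blinfun_apply (integral {0..1} (fx (blinfun_inner_left y))) (blinfun_inner_left v)
        = integral {0..1} (\<lambda>t. blinfun_apply (fx (blinfun_inner_left y) t) (blinfun_inner_left v))"
      using integral_linear[OF integrable_continuous_real[OF cfx] blinfun.bounded_linear_left]
      unfolding o_def by (rule sym)
    also have "\<dots> = integral {0..1} (\<lambda>t. \<Sum>i<n. (v \<bullet> b i) * f' i y t)"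
      by (simp add: fx_def blinfun.sum_left blinfun.scaleR_left ev PJ mult.commute inner_commute)
    also have "\<dots> = (\<Sum>i<n. (v \<bullet> b i) * integral {0..1} (f' i y))"
      by (subst integral_sum) (auto intro!: integrable_continuous_real continuous_intros ci)
    finally show ?thesis .
  qed
  ultimately show ?thesis by (simp add: PJ)
qed

text \<open>The powers of \<open>t\<close> make the induction work: each derivative under the integral sign produces one
  more factor \<open>t\<close> and replaces \<open>F\<close> by a partial derivative.\<close>

lemma Ck_on_integral_segment:
  fixes F :: "'e::real_inner \<Rightarrow> real" and b :: "nat \<Rightarrow> 'e"
  assumes b: "orthonormal_frame n b" and S: "open S" "convex S" and q: "q \<in> S"
    and F: "smooth_on S F"
  shows "Ck_on k S (\<lambda>y. integral {0..1} (\<lambda>t. t ^ m * F (q + t *\<^sub>R (y - q))))"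
  using F
proof (induction k arbitrary: m F)
  have seg: "q + t *\<^sub>R (y - q) \<in> S" if "y \<in> S" "t \<in> {0..1}" for y t
  proof -
    have "(1 - t) *\<^sub>R q + t *\<^sub>R y \<in> S" using S(2) q that by (simp add: convex_alt)
    then show ?thesis by (simp add: algebra_simps)
  qed
  have cont: "continuous_on (S \<times> {0..1}) (\<lambda>(y, t). t ^ m * F (q + t *\<^sub>R (y - q)))"
    if "smooth_on S F" for m and F :: "'e \<Rightarrow> real"
  proof -
    have "continuous_on S F" using that Ck_on.simps(1) by (metis smooth_on_def)
    moreover have "continuous_on (S \<times> {0..1}) (\<lambda>x. q + snd x *\<^sub>R (fst x - q))"
      by (intro continuous_intros)
    ultimately have "continuous_on (S \<times> {0..1}) (\<lambda>x. F (q + snd x *\<^sub>R (fst x - q)))"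
      by (rule continuous_on_compose2) (auto intro: seg)
    then show ?thesis unfolding case_prod_unfold by (intro continuous_intros)
  qed
  {
    case 0
    then show ?case
      using integral_continuous_on_param[of S 0 1 "\<lambda>y t. t ^ m * F (q + t *\<^sub>R (y - q))"] cont by simp
  next
    case (Suc k)
    have dF: "smooth_on S (\<lambda>x. frechet_derivative F (at x) v)" for v
      using Suc.prems Ck_on_SucD(2) unfolding smooth_on_def by blast
    have FD: "(F has_derivative frechet_derivative F (at y)) (at y)" if "y \<in> S" for y
      using Suc.prems Ck_on_SucD(1) that unfolding smooth_on_def by blast
    show ?case
    proof (rule Ck_on_SucI[OF S(1) leibniz_rule_orthonormal_frame[OF b S]])
      fix y t assume yt: "y \<in> S" "t \<in> {0..1::real}"
      have "((\<lambda>y. F (q + t *\<^sub>R (y - q))) has_derivative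
          (\<lambda>v. frechet_derivative F (at (q + t *\<^sub>R (y - q))) (t *\<^sub>R v))) (at y)"
        by (rule has_derivative_compose[of "\<lambda>y. q + t *\<^sub>R (y - q)" "\<lambda>v. t *\<^sub>R v" y UNIV F,
              OF _ FD[OF seg[OF yt]]]) (auto intro!: derivative_eq_intros)
      then have "((\<lambda>y. t ^ m * F (q + t *\<^sub>R (y - q))) has_derivative
          (\<lambda>v. t ^ m * frechet_derivative F (at (q + t *\<^sub>R (y - q))) (t *\<^sub>R v))) (at y)"
        by (rule has_derivative_mult_right)
      moreover have "t ^ m * frechet_derivative F (at (q + t *\<^sub>R (y - q))) (t *\<^sub>R v) =
          (\<Sum>i<n. (v \<bullet> b i) * (t ^ Suc m * frechet_derivative F (at (q + t *\<^sub>R (y - q))) (b i)))" for v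
        using linear_orthonormal_frame[OF b has_derivative_linear[OF FD[OF seg[OF yt]]], of "t *\<^sub>R v"]
        by (simp add: sum_distrib_left mult_ac)
      ultimately show "((\<lambda>y. t ^ m * F (q + t *\<^sub>R (y - q))) has_derivative
          (\<lambda>v. \<Sum>i<n. (v \<bullet> b i) * (t ^ Suc m * frechet_derivative F (at (q + t *\<^sub>R (y - q))) (b i)))) (at y)"
        by simp
    next
      fix y assume y: "y \<in> S"
      have "continuous_on {0..1} (\<lambda>t::real. (y, t))" by (intro continuous_intros)
      note continuous_on_compose2[OF cont[OF Suc.prems, of m] this]
      moreover have "(\<lambda>t. (y, t)) ` {0..1} \<subseteq> S \<times> {0..1::real}" using y by auto
      ultimately show "(\<lambda>t. t ^ m * F (q + t *\<^sub>R (y - q))) integrable_on {0..1}"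
        by (intro integrable_continuous_real) (simp add: case_prod_unfold)
    next
      show "continuous_on (S \<times> {0..1}) (\<lambda>(y, t). t ^ Suc m * frechet_derivative F (at (q + t *\<^sub>R (y - q))) (b i))" for i
        by (rule cont[OF dF])
      show "Ck_on k S (\<lambda>y. \<Sum>i<n. (v \<bullet> b i) *
          integral {0..1} (\<lambda>t. t ^ Suc m * frechet_derivative F (at (q + t *\<^sub>R (y - q))) (b i)))" for v
        by (intro Ck_on_sum Ck_on_mult Ck_on_const Suc.IH dF S(1))
    qed
  }
qed

text \<open>The remainders are \<open>G i y = \<integral>\<^sub>0\<^sup>1 (\<partial>\<^sub>i F)(q + t (y - q)) dt\<close>; the expansion is the fundamental theorem of
  calculus on the segment from \<open>q\<close> to \<open>y\<close>. Smoothness of the remainders is the point: it lets a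
  derivation be applied to the expansion.\<close>

lemma hadamard:
  fixes F :: "'e::real_inner \<Rightarrow> real" and b :: "nat \<Rightarrow> 'e"
  assumes b: "orthonormal_frame n b" and S: "open S" "convex S" and q: "q \<in> S"
    and F: "smooth_on S F"
  obtains G where "\<forall>i<n. smooth_on S (G i)"
    "\<forall>i<n. G i q = frechet_derivative F (at q) (b i)"
    "\<forall>y\<in>S. F y = F q + (\<Sum>i<n. ((y - q) \<bullet> b i) * G i y)"
proof
  define dF where "dF i x = frechet_derivative F (at x) (b i)" for i x
  define G where "G i y = integral {0..1} (\<lambda>t. t ^ 0 * dF i (q + t *\<^sub>R (y - q)))" for i y
  have dF: "smooth_on S (dF i)" for i
    using F Ck_on_SucD(2) unfolding smooth_on_def dF_def by blast
  have FD: "(F has_derivative frechet_derivative F (at y)) (at y)" if "y \<in> S" for y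
    using F Ck_on_SucD(1) that unfolding smooth_on_def by blast
  show "\<forall>i<n. smooth_on S (G i)"
    unfolding smooth_on_def G_def using Ck_on_integral_segment[OF b S q dF] by blast
  show "\<forall>i<n. G i q = frechet_derivative F (at q) (b i)"
    by (simp add: G_def dF_def)
  show "\<forall>y\<in>S. F y = F q + (\<Sum>i<n. ((y - q) \<bullet> b i) * G i y)"
  proof
    fix y assume y: "y \<in> S"
    have seg: "q + t *\<^sub>R (y - q) \<in> S" if "t \<in> {0..1}" for t
    proof -
      have "(1 - t) *\<^sub>R q + t *\<^sub>R y \<in> S" using S(2) q that y by (simp add: convex_alt)
      then show ?thesis by (simp add: algebra_simps)
    qed
    have "((\<lambda>t. \<Sum>i<n. ((y - q) \<bullet> b i) * dF i (q + t *\<^sub>R (y - q))) has_integral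
        F (q + 1 *\<^sub>R (y - q)) - F (q + 0 *\<^sub>R (y - q))) {0..1}"
    proof (rule fundamental_theorem_of_calculus)
      fix t :: real assume t: "t \<in> {0..1}"
      have "((\<lambda>t. F (q + t *\<^sub>R (y - q))) has_derivative
          (\<lambda>s. frechet_derivative F (at (q + t *\<^sub>R (y - q))) (s *\<^sub>R (y - q)))) (at t within {0..1})"
        by (rule has_derivative_compose[of "\<lambda>t. q + t *\<^sub>R (y - q)" "\<lambda>s. s *\<^sub>R (y - q)" t "{0..1}" F,
              OF _ FD[OF seg[OF t]]]) (auto intro!: derivative_eq_intros)
      moreover have "frechet_derivative F (at (q + t *\<^sub>R (y - q))) (s *\<^sub>R (y - q)) =
          s *\<^sub>R (\<Sum>i<n. ((y - q) \<bullet> b i) * dF i (q + t *\<^sub>R (y - q)))" for s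
        using linear_orthonormal_frame[OF b has_derivative_linear[OF FD[OF seg[OF t]]], of "s *\<^sub>R (y - q)"]
        by (simp add: sum_distrib_left mult_ac dF_def)
      ultimately show "((\<lambda>t. F (q + t *\<^sub>R (y - q))) has_vector_derivative
          (\<Sum>i<n. ((y - q) \<bullet> b i) * dF i (q + t *\<^sub>R (y - q)))) (at t within {0..1})"
        by (simp add: has_vector_derivative_def)
    qed simp
    moreover have "((\<lambda>t. \<Sum>i<n. ((y - q) \<bullet> b i) * dF i (q + t *\<^sub>R (y - q))) has_integral
        (\<Sum>i<n. ((y - q) \<bullet> b i) * G i y)) {0..1}"
    proof (intro has_integral_sum has_integral_mult_right)
      fix i
      have "continuous_on S (dF i)" using dF[of i] Ck_on.simps(1) by (metis smooth_on_def)
      then have "continuous_on {0..1} (\<lambda>t. dF i (q + t *\<^sub>R (y - q)))"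
        by (rule continuous_on_compose2) (auto intro!: continuous_intros seg)
      then show "((\<lambda>t. dF i (q + t *\<^sub>R (y - q))) has_integral G i y) {0..1}"
        unfolding G_def by (simp add: integrable_integral integrable_continuous_real)
    qed simp
    ultimately have "F (q + 1 *\<^sub>R (y - q)) - F (q + 0 *\<^sub>R (y - q)) = (\<Sum>i<n. ((y - q) \<bullet> b i) * G i y)"
      by (rule has_integral_unique)
    then show "F y = F q + (\<Sum>i<n. ((y - q) \<bullet> b i) * G i y)" by simp
  qed
qed

section \<open>Smooth functions and vector fields on a manifold\<close>

locale manifold =
  fixes A :: "('a::{t2_space, second_countable_topology}, 'e::real_inner) chart set"
  assumes manifold: "smooth_manifold A"
begin

abbreviation SF where "SF \<equiv> smooth_functions A"
abbreviation VF where "VF \<equiv> vector_fields A"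
abbreviation TS where "TS \<equiv> tangent_space A"

subsection \<open>Charts\<close>

lemma chart:
  assumes "(U, \<phi>) \<in> A"
  shows "open U" "open (\<phi> ` U)" "homeomorphism U (\<phi> ` U) \<phi> (inv_into U \<phi>)"
  using manifold assms unfolding smooth_manifold_def by fast+

lemma chart_at: obtains U \<phi> where "(U, \<phi>) \<in> A" "x \<in> U"
proof -
  have "x \<in> (\<Union>(U, \<phi>)\<in>A. U)" using manifold unfolding smooth_manifold_def by simp
  then show ?thesis using that by auto
qed

lemma chart_inv:
  assumes "(U, \<phi>) \<in> A"
  shows "x \<in> U \<Longrightarrow> inv_into U \<phi> (\<phi> x) = x"
    and "y \<in> \<phi> ` U \<Longrightarrow> \<phi> (inv_into U \<phi> y) = y"
    and "y \<in> \<phi> ` U \<Longrightarrow> inv_into U \<phi> y \<in> U"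
  using chart(3)[OF assms] by (auto simp: homeomorphism_def inv_into_into)

lemma open_chart_image:
  assumes "(U, \<phi>) \<in> A" "open O'" "O' \<subseteq> U"
  shows "open (\<phi> ` O')"
proof -
  have "openin (top_of_set U) O'" using assms(2,3) by (simp add: open_subset)
  then have "openin (top_of_set (\<phi> ` U)) (\<phi> ` O')"
    using homeomorphism_imp_open_map[OF chart(3)[OF assms(1)]] by blast
  then show ?thesis using chart(2)[OF assms(1)] openin_open_trans by blast
qed

lemma smooth_on_chart:
  assumes "f \<in> SF" "(U, \<phi>) \<in> A"
  shows "smooth_on (\<phi> ` U) (f \<circ> inv_into U \<phi>)"
  using assms unfolding smooth_functions_def by fast

lemma Ck_on_chart:
  assumes "f \<in> SF" "(U, \<phi>) \<in> A"
  shows "Ck_on k (\<phi> ` U) (\<lambda>y. f (inv_into U \<phi> y))"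
  using smooth_on_chart[OF assms] unfolding smooth_on_def o_def by blast

lemma smooth_functionI:
  assumes "\<And>U \<phi> k. (U, \<phi>) \<in> A \<Longrightarrow> Ck_on k (\<phi> ` U) (\<lambda>y. f (inv_into U \<phi> y))"
  shows "f \<in> SF"
  using assms unfolding smooth_functions_def smooth_on_def o_def by blast

lemma SF_const: "(\<lambda>x. c) \<in> SF"
  by (rule smooth_functionI) (intro Ck_on_const chart(2))

lemma SF_add: "f \<in> SF \<Longrightarrow> h \<in> SF \<Longrightarrow> (\<lambda>x. f x + h x) \<in> SF"
  by (rule smooth_functionI, rule Ck_on_add) (simp_all add: chart(2) Ck_on_chart)

lemma SF_mult: "f \<in> SF \<Longrightarrow> h \<in> SF \<Longrightarrow> (\<lambda>x. f x * h x) \<in> SF"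
  by (rule smooth_functionI, rule Ck_on_mult) (simp_all add: chart(2) Ck_on_chart)

lemma SF_diff: "f \<in> SF \<Longrightarrow> h \<in> SF \<Longrightarrow> (\<lambda>x. f x - h x) \<in> SF"
  using SF_add[OF _ SF_mult[OF SF_const[of "-1"]], of f h] by simp

lemma SF_sum: "(\<And>i. i \<in> I \<Longrightarrow> f i \<in> SF) \<Longrightarrow> (\<lambda>x. \<Sum>i\<in>I. f i x) \<in> SF"
  by (rule smooth_functionI, rule Ck_on_sum) (simp_all add: chart(2) Ck_on_chart)

lemmas SF_intros = SF_const SF_add SF_mult SF_diff SF_sum

lemma SF_continuous:
  assumes "f \<in> SF"
  shows "continuous_on UNIV f"
proof (intro continuous_at_imp_continuous_on ballI)
  fix x
  obtain U \<phi> where U: "(U, \<phi>) \<in> A" "x \<in> U" by (rule chart_at)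
  have "continuous_on (\<phi> ` U) (\<lambda>y. f (inv_into U \<phi> y))"
    using Ck_on_chart[OF assms U(1), of 0] by simp
  then have "continuous_on U (\<lambda>z. f (inv_into U \<phi> (\<phi> z)))"
    by (rule continuous_on_compose2) (use homeomorphism_cont1[OF chart(3)[OF U(1)]] in auto)
  then have "continuous_on U f"
    by (rule continuous_on_eq) (simp add: chart_inv(1)[OF U(1)])
  then show "isCont f x" using U chart(1) continuous_on_eq_continuous_at by blast
qed

lemma open_nonzero: "f \<in> SF \<Longrightarrow> open {x. f x \<noteq> 0}"
  using open_Collect_neq[OF SF_continuous continuous_on_const] .

text \<open>This is how smoothness is checked everywhere below without a notion of locally defined smooth
  functions: it suffices to exhibit global numerators and denominators.\<close>

lemma smooth_function_local_quotient:
  assumes "\<And>p. \<exists>s\<in>SF. \<exists>d\<in>SF. d p \<noteq> 0 \<and> (\<forall>x. d x \<noteq> 0 \<longrightarrow> u x = s x / d x)"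
  shows "u \<in> SF"
proof (rule smooth_functionI)
  fix U \<phi> k assume U: "(U, \<phi>) \<in> A"
  show "Ck_on k (\<phi> ` U) (\<lambda>y. u (inv_into U \<phi> y))"
  proof (rule Ck_on_local[OF _ chart(2)[OF U]])
    fix y assume y: "y \<in> \<phi> ` U"
    obtain s d where sd: "s \<in> SF" "d \<in> SF" "d (inv_into U \<phi> y) \<noteq> 0"
      "\<And>x. d x \<noteq> 0 \<Longrightarrow> u x = s x / d x" using assms by metis
    define N where "N = \<phi> ` (U \<inter> {x. d x \<noteq> 0})"
    have N: "open N" "N \<subseteq> \<phi> ` U"
      unfolding N_def using open_chart_image[OF U] chart(1)[OF U] open_nonzero[OF sd(2)] by auto
    have dN: "d (inv_into U \<phi> z) \<noteq> 0" if "z \<in> N" for z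
      using that chart_inv(1)[OF U] unfolding N_def by auto
    have "y \<in> N" unfolding N_def
      using chart_inv(2,3)[OF U y] sd(3) by (intro image_eqI[of _ _ "inv_into U \<phi> y"]) auto
    moreover have "Ck_on k N (\<lambda>z. u (inv_into U \<phi> z))"
    proof (rule Ck_on_cong[OF N(1)])
      show "Ck_on k N (\<lambda>z. s (inv_into U \<phi> z) / d (inv_into U \<phi> z))"
        by (intro Ck_on_divide N dN Ck_on_subset[OF Ck_on_chart[OF _ U] N(2)] sd)
    qed (use sd(4) dN in simp)
    ultimately show "\<exists>O'. open O' \<and> y \<in> O' \<and> Ck_on k (O' \<inter> \<phi> ` U) (\<lambda>y. u (inv_into U \<phi> y))"
      using N by (metis inf.absorb1)
  qed
qed

subsection \<open>Tangent vectors\<close>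

lemma tangent_space_add: "v \<in> TS x \<Longrightarrow> f \<in> SF \<Longrightarrow> h \<in> SF \<Longrightarrow> v (\<lambda>y. f y + h y) = v f + v h"
  and tangent_space_cmult: "v \<in> TS x \<Longrightarrow> f \<in> SF \<Longrightarrow> v (\<lambda>y. c * f y) = c * v f"
  and tangent_space_mult: "v \<in> TS x \<Longrightarrow> f \<in> SF \<Longrightarrow> h \<in> SF \<Longrightarrow>
    v (\<lambda>y. f y * h y) = f x * v h + h x * v f"
  and tangent_space_nonsmooth: "v \<in> TS x \<Longrightarrow> f \<notin> SF \<Longrightarrow> v f = 0"
  by (simp_all add: tangent_space_def)

lemma tangent_space_const:
  assumes "v \<in> TS x"
  shows "v (\<lambda>y. c) = 0"
proof -
  have "v (\<lambda>y. 1 * 1) = 1 * v (\<lambda>y. 1) + 1 * v (\<lambda>y. 1)"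
    by (rule tangent_space_mult[OF assms SF_const SF_const])
  then have "v (\<lambda>y. 1) = 0" by simp
  then show ?thesis using tangent_space_cmult[OF assms SF_const, of c 1] by simp
qed

lemma tangent_space_diff:
  assumes "v \<in> TS x" "f \<in> SF" "h \<in> SF"
  shows "v (\<lambda>y. f y - h y) = v f - v h"
  using tangent_space_add[OF assms(1,2) SF_mult[OF SF_const assms(3)], of "-1"]
    tangent_space_cmult[OF assms(1,3), of "-1"] by simp

lemma tangent_space_sum:
  assumes "v \<in> TS x" "\<And>i. i \<in> I \<Longrightarrow> f i \<in> SF"
  shows "v (\<lambda>y. \<Sum>i\<in>I. f i y) = (\<Sum>i\<in>I. v (f i))"
  using assms(2)
proof (induction I rule: infinite_finite_induct)
  case (insert i I)
  then show ?case by (simp add: tangent_space_add[OF assms(1)] SF_sum)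
qed (simp_all add: tangent_space_const[OF assms(1)])

lemma subspace_tangent_space: "subspace (TS x)"
  by (auto simp: subspace_def tangent_space_def scaleR_fun_def algebra_simps)

lemmas tangent_space_closed =
  subspace_add[OF subspace_tangent_space] subspace_scale[OF subspace_tangent_space]
  subspace_sum[OF subspace_tangent_space] subspace_0[OF subspace_tangent_space]
  subspace_diff[OF subspace_tangent_space] subspace_neg[OF subspace_tangent_space]

lemma tvec_sum_apply: "(\<Sum>i\<in>I. v i) f = (\<Sum>i\<in>I. v i f)" for v :: "'i \<Rightarrow> 'b \<Rightarrow> real"
  by (induction I rule: infinite_finite_induct) simp_all

lemma vector_field_tangent: "X \<in> VF \<Longrightarrow> X x \<in> TS x"
  and vector_field_smooth: "X \<in> VF \<Longrightarrow> f \<in> SF \<Longrightarrow> (\<lambda>x. X x f) \<in> SF"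
  by (simp_all add: vector_fields_def)

lemma vector_fieldI:
  "(\<And>x. X x \<in> TS x) \<Longrightarrow> (\<And>f. f \<in> SF \<Longrightarrow> (\<lambda>x. X x f) \<in> SF) \<Longrightarrow> X \<in> VF"
  by (simp add: vector_fields_def)

lemma VF_add:
  assumes "X \<in> VF" "Y \<in> VF"
  shows "X + Y \<in> VF"
proof (rule vector_fieldI)
  show "(X + Y) x \<in> TS x" for x
    using assms by (simp add: tangent_space_closed vector_field_tangent)
  show "(\<lambda>x. (X + Y) x f) \<in> SF" if "f \<in> SF" for f
    using SF_add[OF vector_field_smooth[OF assms(1) that] vector_field_smooth[OF assms(2) that]] by simp
qed

lemma VF_scale:
  assumes "f \<in> SF" "X \<in> VF"
  shows "(\<lambda>x. f x *\<^sub>R X x) \<in> VF"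
proof (rule vector_fieldI)
  show "f x *\<^sub>R X x \<in> TS x" for x
    using assms by (simp add: tangent_space_closed vector_field_tangent)
  show "(\<lambda>x. (f x *\<^sub>R X x) h) \<in> SF" if "h \<in> SF" for h
    using SF_mult[OF assms(1) vector_field_smooth[OF assms(2) that]] by (simp add: scaleR_fun_def)
qed

lemma VF_sum:
  assumes "\<And>i. i \<in> I \<Longrightarrow> X i \<in> VF"
  shows "(\<lambda>x. \<Sum>i\<in>I. X i x) \<in> VF"
proof (rule vector_fieldI)
  show "(\<Sum>i\<in>I. X i x) \<in> TS x" for x
    using assms by (intro tangent_space_closed vector_field_tangent)
  show "(\<lambda>x. (\<Sum>i\<in>I. X i x) f) \<in> SF" if "f \<in> SF" for f
    using SF_sum[OF vector_field_smooth[OF assms that]] by (simp add: tvec_sum_apply)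
qed

lemma VF_lie_bracket:
  assumes X: "X \<in> VF" and Y: "Y \<in> VF"
  shows "lie_bracket X Y \<in> VF"
proof (rule vector_fieldI)
  fix x
  note tX = vector_field_tangent[OF X] and tY = vector_field_tangent[OF Y]
  note sX = vector_field_smooth[OF X] and sY = vector_field_smooth[OF Y]
  note rules = tangent_space_add[OF tX] tangent_space_add[OF tY] tangent_space_cmult[OF tX]
    tangent_space_cmult[OF tY] tangent_space_mult[OF tX] tangent_space_mult[OF tY]
    tangent_space_nonsmooth[OF tX] tangent_space_nonsmooth[OF tY]
    tangent_space_const[OF tX] tangent_space_const[OF tY] sX sY SF_intros
  show "lie_bracket X Y x \<in> TS x"
    unfolding tangent_space_def mem_Collect_eq
  proof (intro conjI ballI allI impI)
    fix f h assume f: "f \<in> SF" and h: "h \<in> SF"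
    show "lie_bracket X Y x (\<lambda>y. f y + h y) = lie_bracket X Y x f + lie_bracket X Y x h"
      using f h by (simp add: lie_bracket_def rules)
    show "lie_bracket X Y x (\<lambda>y. f y * h y) = f x * lie_bracket X Y x h + h x * lie_bracket X Y x f"
      using f h by (simp add: lie_bracket_def rules algebra_simps)
  next
    fix c f assume f: "f \<in> SF"
    show "lie_bracket X Y x (\<lambda>y. c * f y) = c * lie_bracket X Y x f"
      using f by (simp add: lie_bracket_def rules algebra_simps)
  next
    fix f assume f: "f \<notin> SF"
    show "lie_bracket X Y x f = 0"
      using f by (simp add: lie_bracket_def rules)
  qed
  show "(\<lambda>x. lie_bracket X Y x f) \<in> SF" if "f \<in> SF" for f
    using that unfolding lie_bracket_def by (intro SF_diff sX sY)
qed

subsection \<open>Local frames\<close>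

definition bump_extension :: "'a set \<Rightarrow> ('a \<Rightarrow> 'e) \<Rightarrow> 'e \<Rightarrow> real \<Rightarrow> ('e \<Rightarrow> real) \<Rightarrow> 'a \<Rightarrow> real" where
  "bump_extension U \<phi> c R u = (\<lambda>x. if x \<in> U then bump c R (\<phi> x) * u (\<phi> x) else 0)"

text \<open>The closed ball is compact, so its preimage in the chart domain is compact, hence closed in the Hausdorff manifold, and the function
  vanishes on the open complement of that preimage. Near the preimage it is smooth in every
  other chart because the transition maps are.\<close>

lemma bump_extension_smooth:
  assumes b: "orthonormal_frame n (b :: nat \<Rightarrow> 'e)" and U: "(U, \<phi>) \<in> A" and R: "R > 0"
    and S: "open S" "cball c R \<subseteq> S" "S \<subseteq> \<phi> ` U" and u: "smooth_on S u"
  shows "bump_extension U \<phi> c R u \<in> SF"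
proof (rule smooth_functionI)
  fix V \<psi> k assume V: "(V, \<psi>) \<in> A"
  let ?i = "inv_into V \<psi>"
  define K where "K = inv_into U \<phi> ` cball c R"
  have "compact K" unfolding K_def
    using compact_cball_orthonormal_frame[OF b] S(2,3) homeomorphism_cont2[OF chart(3)[OF U]]
    by (meson compact_continuous_image continuous_on_subset order_trans)
  then have K: "closed K" by (rule compact_imp_closed)
  show "Ck_on k (\<psi> ` V) (\<lambda>y. bump_extension U \<phi> c R u (?i y))"
  proof (rule Ck_on_local[OF _ chart(2)[OF V]])
    fix y assume y: "y \<in> \<psi> ` V"
    note iy = chart_inv(2,3)[OF V y]
    show "\<exists>O'. open O' \<and> y \<in> O' \<and> Ck_on k (O' \<inter> \<psi> ` V) (\<lambda>y. bump_extension U \<phi> c R u (?i y))"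
    proof (cases "?i y \<in> K")
      case True
      define W where "W = inv_into U \<phi> ` S"
      have "W = U \<inter> \<phi> -` S"
        unfolding W_def using S(3) chart_inv[OF U] by (force simp: image_iff)
      then have W: "open W" "W \<subseteq> U" "\<And>z. z \<in> W \<Longrightarrow> \<phi> z \<in> S"
        using continuous_open_preimage[OF homeomorphism_cont1[OF chart(3)[OF U]] chart(1)[OF U] S(1)]
        by auto
      define N where "N = \<psi> ` (V \<inter> W)"
      have N: "open N" "N \<subseteq> \<psi> ` (V \<inter> U)" "N \<subseteq> \<psi> ` V"
        unfolding N_def using open_chart_image[OF V] chart(1)[OF V] W by auto
      have iN: "?i z \<in> W" if "z \<in> N" for z
        using that chart_inv(1)[OF V] unfolding N_def by auto
      have "y \<in> N" unfolding N_def
        using iy True S(2) by (intro image_eqI[of _ _ "?i y"]) (auto simp: W_def K_def)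
      moreover have "Ck_on k N (\<lambda>y. bump_extension U \<phi> c R u (?i y))"
      proof (rule Ck_on_cong[OF N(1)])
        have "smooth_on (\<psi> ` (V \<inter> U)) (\<phi> \<circ> ?i)"
          using manifold U V unfolding smooth_manifold_def by fast
        then have "Ck_on k N (\<lambda>z. \<phi> (?i z))"
          using Ck_on_subset[OF _ N(2)] unfolding smooth_on_def o_def by blast
        then show "Ck_on k N (\<lambda>z. bump c R (\<phi> (?i z)) * u (\<phi> (?i z)))"
          by (rule Ck_on_compose[OF b N(1) S(1), where F = "\<lambda>y. bump c R y * u y", rotated])
             (use u iN W(3) in \<open>auto simp: smooth_on_def intro!: Ck_on_mult S
               Ck_on_subset[OF Ck_on_bump[OF b]]\<close>)
      qed (use iN W(2) in \<open>auto simp: bump_extension_def\<close>)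
      ultimately show ?thesis using N by (metis inf.absorb1)
    next
      case False
      define N where "N = \<psi> ` (V - K)"
      have N: "open N" "N \<subseteq> \<psi> ` V"
        unfolding N_def using open_chart_image[OF V] chart(1)[OF V] K by auto
      have iN: "?i z \<in> V - K" if "z \<in> N" for z
        using that chart_inv(1)[OF V] unfolding N_def by auto
      have "y \<in> N" unfolding N_def
        using iy False by (intro image_eqI[of _ _ "?i y"]) auto
      moreover have "Ck_on k N (\<lambda>y. bump_extension U \<phi> c R u (?i y))"
      proof (rule Ck_on_cong[OF N(1) _ Ck_on_const[OF N(1)]])
        fix z assume "z \<in> N"
        then have "?i z \<notin> K" using iN by blast
        then have "?i z \<in> U \<Longrightarrow> \<phi> (?i z) \<notin> cball c R"
          unfolding K_def using chart_inv(1)[OF U] by (metis image_eqI)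
        then show "0 = bump_extension U \<phi> c R u (?i z)"
          using bump_eq_0[OF _ R] by (auto simp: bump_extension_def)
      qed
      ultimately show ?thesis using N by (metis inf.absorb1)
    qed
  qed
qed

text \<open>The coordinate field in direction \<open>e\<close>, cut off by the bump function. On non-smooth functions it is
  zero, as \<open>tangent_space\<close> demands.\<close>

definition chart_field :: "'a set \<Rightarrow> ('a \<Rightarrow> 'e) \<Rightarrow> 'e \<Rightarrow> real \<Rightarrow> 'e \<Rightarrow> 'a vfield" where
  "chart_field U \<phi> c R e = (\<lambda>x f. if f \<in> SF then
     bump_extension U \<phi> c R (\<lambda>y. frechet_derivative (f \<circ> inv_into U \<phi>) (at y) e) x else 0)"

lemma has_derivative_chart:
  assumes "f \<in> SF" "(U, \<phi>) \<in> A" "x \<in> U"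
  shows "(f \<circ> inv_into U \<phi> has_derivative frechet_derivative (f \<circ> inv_into U \<phi>) (at (\<phi> x))) (at (\<phi> x))"
  using Ck_on_SucD(1)[of 0 "\<phi> ` U" "f \<circ> inv_into U \<phi>" "\<phi> x"] smooth_on_chart[OF assms(1,2)] assms(3)
  unfolding smooth_on_def by blast

lemma chart_field_in_VF:
  assumes b: "orthonormal_frame n (b :: nat \<Rightarrow> 'e)" and U: "(U, \<phi>) \<in> A" and R: "R > 0"
    and c: "cball c R \<subseteq> \<phi> ` U"
  shows "chart_field U \<phi> c R e \<in> VF"
proof (rule vector_fieldI)
  fix x
  note D = has_derivative_chart[OF _ U]
  show "chart_field U \<phi> c R e x \<in> TS x"
  proof (cases "x \<in> U")
    case False
    then show ?thesis
      by (auto simp: chart_field_def bump_extension_def tangent_space_def)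
  next
    case x: True
    have add: "frechet_derivative ((\<lambda>y. f y + h y) \<circ> inv_into U \<phi>) (at (\<phi> x)) e =
        frechet_derivative (f \<circ> inv_into U \<phi>) (at (\<phi> x)) e + frechet_derivative (h \<circ> inv_into U \<phi>) (at (\<phi> x)) e"
      if "f \<in> SF" "h \<in> SF" for f h
      using frechet_derivative_at[OF has_derivative_add[OF D[OF that(1) x] D[OF that(2) x]]]
      by (simp add: o_def) (metis (lifting))
    have mult: "frechet_derivative ((\<lambda>y. f y * h y) \<circ> inv_into U \<phi>) (at (\<phi> x)) e =
        f x * frechet_derivative (h \<circ> inv_into U \<phi>) (at (\<phi> x)) e + frechet_derivative (f \<circ> inv_into U \<phi>) (at (\<phi> x)) e * h x"
      if "f \<in> SF" "h \<in> SF" for f h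
      using frechet_derivative_at[OF has_derivative_mult[OF D[OF that(1) x] D[OF that(2) x]]]
      by (simp add: o_def chart_inv(1)[OF U x]) (metis (lifting))
    have cmult: "frechet_derivative ((\<lambda>y. k * f y) \<circ> inv_into U \<phi>) (at (\<phi> x)) e =
        k * frechet_derivative (f \<circ> inv_into U \<phi>) (at (\<phi> x)) e"
      if "f \<in> SF" for f k
      using frechet_derivative_at[OF has_derivative_mult_right[OF D[OF that(1) x], of k]]
      by (simp add: o_def) (metis (lifting))
    show ?thesis
      unfolding tangent_space_def using x
      by (auto simp: chart_field_def bump_extension_def SF_intros add mult cmult algebra_simps)
  qed
next
  fix f assume f: "f \<in> SF"
  have "smooth_on (\<phi> ` U) (\<lambda>y. frechet_derivative (f \<circ> inv_into U \<phi>) (at y) e)"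
    using smooth_on_chart[OF f U] Ck_on_SucD(2) unfolding smooth_on_def by blast
  then show "(\<lambda>x. chart_field U \<phi> c R e x f) \<in> SF"
    using bump_extension_smooth[OF b U R chart(2)[OF U] c subset_refl] f
    by (simp add: chart_field_def)
qed

text \<open>A derivation is determined by its values on the coordinates. Let \<open>q = \<phi> x\<close>. Hadamard's lemma at
  \<open>q\<close>, multiplied by the square of the bump function \<open>\<beta>\<close>, is an identity of global smooth functions
  \<open>\<beta>\<^sup>2 f = f(x) \<beta>\<^sup>2 + \<Sum>\<^sub>i (\<kappa>\<^sub>i - q\<^sub>i \<beta>) \<gamma>\<^sub>i\<close>, where \<open>\<kappa>\<^sub>i\<close> and \<open>\<gamma>\<^sub>i\<close> are the cut-off coordinates and
  remainders. Each factor \<open>\<kappa>\<^sub>i - q\<^sub>i \<beta>\<close> vanishes at \<open>x\<close>, so applying \<open>v\<close> leaves only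
  the values \<open>\<gamma>\<^sub>i(x) = \<beta>(x) \<partial>\<^sub>i f(q)\<close>.\<close>

lemma tangent_vector_in_chart:
  assumes b: "orthonormal_frame n (b :: nat \<Rightarrow> 'e)" and U: "(U, \<phi>) \<in> A" and R: "0 < R" "R < R'"
    and c: "cball c R' \<subseteq> \<phi> ` U" and x: "x \<in> U" "\<phi> x \<in> ball c R" and v: "v \<in> TS x" and f: "f \<in> SF"
  shows "bump_extension U \<phi> c R (\<lambda>_. 1) x * v f = (\<Sum>i<n. (v (bump_extension U \<phi> c R (\<lambda>y. y \<bullet> b i))
      - (\<phi> x \<bullet> b i) * v (bump_extension U \<phi> c R (\<lambda>_. 1)))
      * frechet_derivative (f \<circ> inv_into U \<phi>) (at (\<phi> x)) (b i))"
proof -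
  let ?S = "ball c R'"
  have S: "open ?S" "convex ?S" "cball c R \<subseteq> ?S" "?S \<subseteq> \<phi> ` U" "\<phi> x \<in> ?S"
    using R c x(2) ball_subset_cball by (auto simp: dist_norm)
  have smooth: "smooth_on ?S (f \<circ> inv_into U \<phi>)"
    using smooth_on_chart[OF f U] Ck_on_subset[OF _ S(4)] unfolding smooth_on_def by blast
  obtain G where
    G: "\<forall>i<n. smooth_on ?S (G i)"
      "\<forall>i<n. G i (\<phi> x) = frechet_derivative (f \<circ> inv_into U \<phi>) (at (\<phi> x)) (b i)"
      "\<forall>y\<in>?S. (f \<circ> inv_into U \<phi>) y = (f \<circ> inv_into U \<phi>) (\<phi> x) + (\<Sum>i<n. ((y - \<phi> x) \<bullet> b i) * G i y)"
    by (rule hadamard[OF b S(1,2,5) smooth])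
  note ext = bump_extension_smooth[OF b U R(1) S(1,3,4)]
  define \<beta> where "\<beta> = bump_extension U \<phi> c R (\<lambda>_. 1)"
  define \<kappa> where "\<kappa> i = bump_extension U \<phi> c R (\<lambda>y. y \<bullet> b i)" for i
  define \<gamma> where "\<gamma> i = bump_extension U \<phi> c R (G i)" for i
  have \<beta>: "\<beta> \<in> SF" unfolding \<beta>_def
    by (rule ext) (simp add: smooth_on_def Ck_on_const)
  have \<kappa>: "\<kappa> i \<in> SF" for i unfolding \<kappa>_def
    by (rule ext) (simp add: smooth_on_def Ck_on_linear bounded_linear_inner_left)
  have \<gamma>: "\<gamma> i \<in> SF" if "i < n" for i unfolding \<gamma>_def
    by (rule ext) (use G(1) that in blast)
  let ?q = "\<lambda>i. \<phi> x \<bullet> b i"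
  have \<beta>x: "\<beta> x \<noteq> 0" using x bump_nonzero_iff[OF R(1)] by (auto simp: \<beta>_def bump_extension_def)
  have "\<beta> z * (\<beta> z * f z) = f x * (\<beta> z * \<beta> z) + (\<Sum>i<n. (\<kappa> i z - ?q i * \<beta> z) * \<gamma> i z)" for z
  proof (cases "z \<in> U \<and> \<phi> z \<in> cball c R")
    case True
    then have "f z = f x + (\<Sum>i<n. ((\<phi> z - \<phi> x) \<bullet> b i) * G i (\<phi> z))"
      using bspec[OF G(3), of "\<phi> z"] S(3) by (auto simp: chart_inv(1)[OF U] x(1))
    then have "\<beta> z * (\<beta> z * f z) =
        f x * (\<beta> z * \<beta> z) + (\<Sum>i<n. \<beta> z * \<beta> z * (((\<phi> z - \<phi> x) \<bullet> b i) * G i (\<phi> z)))"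
      by (simp only: sum_distrib_left[symmetric] distrib_left mult_ac)
    moreover have "\<beta> z * \<beta> z * (((\<phi> z - \<phi> x) \<bullet> b i) * G i (\<phi> z)) = (\<kappa> i z - ?q i * \<beta> z) * \<gamma> i z" for i
      using True by (simp add: \<beta>_def \<kappa>_def \<gamma>_def bump_extension_def inner_diff_left algebra_simps)
    ultimately show ?thesis by simp
  next
    case False
    then have "z \<in> U \<Longrightarrow> bump c R (\<phi> z) = 0" using bump_eq_0[OF _ R(1), of "\<phi> z" c] by blast
    then have "\<beta> z = 0" "\<And>i. \<kappa> i z = 0" by (simp_all add: \<beta>_def \<kappa>_def bump_extension_def)
    then show ?thesis by simp
  qed
  then have identity: "(\<lambda>z. \<beta> z * (\<beta> z * f z)) =
      (\<lambda>z. f x * (\<beta> z * \<beta> z) + (\<Sum>i<n. (\<kappa> i z - ?q i * \<beta> z) * \<gamma> i z))" by blast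
  have factor: "(\<lambda>z. (\<kappa> i z - ?q i * \<beta> z) * \<gamma> i z) \<in> SF" if "i \<in> {..<n}" for i
    using that by (intro SF_mult SF_diff SF_const \<beta> \<kappa> \<gamma>) simp
  from identity have "v (\<lambda>z. \<beta> z * (\<beta> z * f z)) =
      v (\<lambda>z. f x * (\<beta> z * \<beta> z) + (\<Sum>i<n. (\<kappa> i z - ?q i * \<beta> z) * \<gamma> i z))"
    by (simp only:)
  also have "\<dots> = f x * v (\<lambda>z. \<beta> z * \<beta> z) + (\<Sum>i<n. v (\<lambda>z. (\<kappa> i z - ?q i * \<beta> z) * \<gamma> i z))"
  proof -
    have "(\<lambda>z. \<Sum>i<n. (\<kappa> i z - ?q i * \<beta> z) * \<gamma> i z) \<in> SF" by (rule SF_sum[OF factor])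
    moreover have "v (\<lambda>z. \<Sum>i<n. (\<kappa> i z - ?q i * \<beta> z) * \<gamma> i z) =
        (\<Sum>i<n. v (\<lambda>z. (\<kappa> i z - ?q i * \<beta> z) * \<gamma> i z))"
      by (rule tangent_space_sum[OF v factor])
    ultimately show ?thesis
      using tangent_space_add[OF v SF_mult[OF SF_const SF_mult[OF \<beta> \<beta>]]]
        tangent_space_cmult[OF v SF_mult[OF \<beta> \<beta>]] by simp
  qed
  also have "(\<Sum>i<n. v (\<lambda>z. (\<kappa> i z - ?q i * \<beta> z) * \<gamma> i z)) =
      (\<Sum>i<n. (v (\<kappa> i) - ?q i * v \<beta>) * \<gamma> i x)"
  proof (rule sum.cong[OF refl])
    fix i assume "i \<in> {..<n}"
    then have i: "i < n" by simp
    have "v (\<lambda>z. (\<kappa> i z - ?q i * \<beta> z) * \<gamma> i z) =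
        (\<kappa> i x - ?q i * \<beta> x) * v (\<gamma> i) + \<gamma> i x * v (\<lambda>z. \<kappa> i z - ?q i * \<beta> z)"
      by (rule tangent_space_mult[OF v]) (intro SF_intros \<beta> \<kappa> \<gamma> i)+
    moreover have "\<kappa> i x - ?q i * \<beta> x = 0"
      using x by (simp add: \<kappa>_def \<beta>_def bump_extension_def)
    moreover have "v (\<lambda>z. \<kappa> i z - ?q i * \<beta> z) = v (\<kappa> i) - ?q i * v \<beta>"
      using tangent_space_diff[OF v \<kappa> SF_mult[OF SF_const \<beta>], of i "?q i"] tangent_space_cmult[OF v \<beta>]
      by simp
    ultimately show "v (\<lambda>z. (\<kappa> i z - ?q i * \<beta> z) * \<gamma> i z) = (v (\<kappa> i) - ?q i * v \<beta>) * \<gamma> i x"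
      by simp
  qed
  finally have "\<beta> x * (\<beta> x * v f) = (\<Sum>i<n. (v (\<kappa> i) - ?q i * v \<beta>) * \<gamma> i x)"
    using f \<beta> by (simp add: tangent_space_mult[OF v] SF_mult algebra_simps)
  also have "\<dots> = \<beta> x * (\<Sum>i<n. (v (\<kappa> i) - ?q i * v \<beta>) * frechet_derivative (f \<circ> inv_into U \<phi>) (at (\<phi> x)) (b i))"
    unfolding sum_distrib_left
    by (rule sum.cong) (use x G(2) in \<open>simp_all add: \<gamma>_def \<beta>_def bump_extension_def\<close>)
  finally show ?thesis using \<beta>x by (simp add: \<beta>_def \<kappa>_def)
qed

text \<open>A frame on the open set where \<open>d\<close> does not vanish, but with all data global: the last clause expresses
  \<open>d Z\<close>, rather than \<open>Z\<close>, in the frame, so that its coefficients are smooth on the whole manifold.\<close>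

definition local_frame :: "('a \<Rightarrow> real) \<Rightarrow> nat \<Rightarrow> (nat \<Rightarrow> 'a vfield) \<Rightarrow> bool" where
  "local_frame d n E \<longleftrightarrow> d \<in> SF \<and> (\<forall>i<n. E i \<in> VF) \<and>
     (\<forall>x. d x \<noteq> 0 \<longrightarrow>
       (\<forall>v\<in>TS x. \<exists>c. v = (\<Sum>i<n. c i *\<^sub>R E i x)) \<and>
       (\<forall>c. (\<Sum>i<n. c i *\<^sub>R E i x) = 0 \<longrightarrow> (\<forall>i<n. c i = 0))) \<and>
     (\<forall>Z\<in>VF. \<exists>a. (\<forall>i<n. a i \<in> SF) \<and> (\<forall>x. d x *\<^sub>R Z x = (\<Sum>i<n. a i x *\<^sub>R E i x)))"

text \<open>The frame consists of the cut-off coordinate fields of a chart. With \<open>\<beta>\<close> the bump function and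
  \<open>\<kappa>\<^sub>i\<close> the cut-off coordinates, the functional \<open>\<alpha>\<^sub>i(v) = \<beta> v(\<kappa>\<^sub>i) - \<kappa>\<^sub>i v(\<beta>)\<close> is \<open>\<beta>\<^sup>2\<close> times the \<open>i\<close>-th
  coordinate of \<open>v\<close>, and it takes smooth fields to smooth functions. The fields themselves carry one more factor
  \<open>\<beta>\<close>, hence the denominator \<open>d = \<beta>\<^sup>3\<close>.\<close>

lemma local_frame_exists:
  obtains d n E where "local_frame d n E" "d p \<noteq> 0"
proof -
  obtain n and b :: "nat \<Rightarrow> 'e" where b: "orthonormal_frame n b"
    using manifold orthonormal_frame_exists unfolding smooth_manifold_def by metis
  obtain U \<phi> where U: "(U, \<phi>) \<in> A" "p \<in> U" by (rule chart_at)
  define c where "c = \<phi> p"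
  obtain R' where R': "R' > 0" "cball c R' \<subseteq> \<phi> ` U"
    using open_contains_cball chart(2)[OF U(1)] U(2) unfolding c_def by blast
  define R where "R = R' / 2"
  have R: "0 < R" "R < R'" using R'(1) by (auto simp: R_def)
  have cR: "cball c R \<subseteq> \<phi> ` U" using R R'(2) by (meson less_imp_le order_trans subset_cball)
  note ext = bump_extension_smooth[OF b U(1) R(1) chart(2)[OF U(1)] cR subset_refl]
  define \<beta> where "\<beta> = bump_extension U \<phi> c R (\<lambda>_. 1)"
  define \<kappa> where "\<kappa> i = bump_extension U \<phi> c R (\<lambda>y. y \<bullet> b i)" for i
  define E where "E i = chart_field U \<phi> c R (b i)" for i
  have \<beta>: "\<beta> \<in> SF" unfolding \<beta>_def
    by (rule ext) (simp add: smooth_on_def Ck_on_const chart(2)[OF U(1)])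
  have \<kappa>: "\<kappa> i \<in> SF" for i unfolding \<kappa>_def
    by (rule ext) (simp add: smooth_on_def Ck_on_linear bounded_linear_inner_left chart(2)[OF U(1)])
  have E: "E i \<in> VF" for i unfolding E_def by (rule chart_field_in_VF[OF b U(1) R(1) cR])
  have nonzero: "\<beta> x \<noteq> 0 \<longleftrightarrow> x \<in> U \<and> \<phi> x \<in> ball c R" for x
    using bump_nonzero_iff[OF R(1)] by (auto simp: \<beta>_def bump_extension_def)
  define \<alpha> where "\<alpha> i x v = \<beta> x * v (\<kappa> i) - \<kappa> i x * v \<beta>" for i x and v :: "'a tvec"
  define d where "d x = \<beta> x * \<beta> x * \<beta> x" for x
  have expand: "d x *\<^sub>R v = (\<Sum>i<n. \<alpha> i x v *\<^sub>R E i x)" if v: "v \<in> TS x" for x v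
  proof
    fix f
    show "(d x *\<^sub>R v) f = (\<Sum>i<n. \<alpha> i x v *\<^sub>R E i x) f"
    proof (cases "f \<in> SF \<and> \<beta> x \<noteq> 0")
      case True
      then have x: "x \<in> U" "\<phi> x \<in> ball c R" and f: "f \<in> SF" using nonzero by auto
      have "d x * v f = \<beta> x * \<beta> x * (\<Sum>i<n. (v (\<kappa> i) - (\<phi> x \<bullet> b i) * v \<beta>)
          * frechet_derivative (f \<circ> inv_into U \<phi>) (at (\<phi> x)) (b i))"
        using tangent_vector_in_chart[OF b U(1) R R'(2) x v f]
        by (simp add: d_def \<beta>_def \<kappa>_def mult.assoc)
      also have "\<dots> = (\<Sum>i<n. \<alpha> i x v * E i x f)"
        unfolding sum_distrib_left
        by (rule sum.cong[OF refl]) (use x f in \<open>simp add: \<alpha>_def E_def chart_field_def \<beta>_def \<kappa>_def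
            bump_extension_def algebra_simps\<close>)
      finally show ?thesis by (simp add: tvec_sum_apply scaleR_fun_def)
    next
      case False
      then have "E i x f = 0" for i
        by (auto simp: E_def chart_field_def bump_extension_def \<beta>_def)
      moreover have "d x * v f = 0"
        using False tangent_space_nonsmooth[OF v] by (auto simp: d_def)
      ultimately show ?thesis by (simp add: tvec_sum_apply scaleR_fun_def)
    qed
  qed
  have dual: "\<alpha> j x (E i x) = (if i = j then d x else 0)" if "\<beta> x \<noteq> 0" "i < n" "j < n" for i j x
  proof -
    have x: "x \<in> U" "\<phi> x \<in> ball c R" using that nonzero by auto
    let ?D = "\<lambda>f. frechet_derivative (f \<circ> inv_into U \<phi>) (at (\<phi> x))"
    note D = has_derivative_chart[OF _ U(1) x(1)]
    have inner: "((\<lambda>y. y \<bullet> b j) has_derivative (\<lambda>e. e \<bullet> b j)) (at (\<phi> x))"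
      by (rule bounded_linear_imp_has_derivative[OF bounded_linear_inner_left])
    have "((\<lambda>y. (\<beta> \<circ> inv_into U \<phi>) y * (y \<bullet> b j)) has_derivative
        (\<lambda>e. \<beta> x * (e \<bullet> b j) + ?D \<beta> e * (\<phi> x \<bullet> b j))) (at (\<phi> x))"
      using has_derivative_mult[OF D[OF \<beta>] inner] by (simp add: chart_inv(1)[OF U(1) x(1)])
    then have DK: "(\<kappa> j \<circ> inv_into U \<phi> has_derivative
        (\<lambda>e. \<beta> x * (e \<bullet> b j) + ?D \<beta> e * (\<phi> x \<bullet> b j))) (at (\<phi> x))"
      by (rule has_derivative_transform_within_open[OF _ chart(2)[OF U(1)]])
         (use x chart_inv[OF U(1)] in \<open>auto simp: \<beta>_def \<kappa>_def bump_extension_def\<close>)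
    have "?D (\<kappa> j) (b i) = \<beta> x * (b i \<bullet> b j) + ?D \<beta> (b i) * (\<phi> x \<bullet> b j)"
      using fun_cong[OF frechet_derivative_at[OF DK], of "b i"] by (rule sym)
    moreover have "E i x f = \<beta> x * ?D f (b i)" if "f \<in> SF" for f
      using that x(1) by (simp add: E_def chart_field_def bump_extension_def \<beta>_def)
    moreover have "\<kappa> j x = \<beta> x * (\<phi> x \<bullet> b j)"
      using x(1) by (simp add: \<kappa>_def \<beta>_def bump_extension_def)
    ultimately have "\<alpha> j x (E i x) = d x * (b i \<bullet> b j)"
      using \<beta> \<kappa> by (simp add: \<alpha>_def d_def distrib_left mult_ac)
    then show ?thesis by (simp add: orthonormal_frame_inner[OF b that(2,3)])
  qed
  have "local_frame d n E"
    unfolding local_frame_def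
  proof (intro conjI allI impI ballI)
    show "d \<in> SF" unfolding d_def by (intro SF_mult \<beta>)
    show "E i \<in> VF" for i by (rule E)
  next
    fix x v assume "d x \<noteq> 0" "v \<in> TS x"
    then have "v = (\<Sum>i<n. (\<alpha> i x v / d x) *\<^sub>R E i x)"
      using arg_cong[OF expand[of v x], of "(*\<^sub>R) (inverse (d x))"]
      by (simp add: scaleR_sum_right divide_inverse mult.commute)
    then show "\<exists>c. v = (\<Sum>i<n. c i *\<^sub>R E i x)"
      by (intro exI[where x = "\<lambda>i. \<alpha> i x v / d x"])
  next
    fix x c j assume x: "d x \<noteq> 0" and c: "(\<Sum>i<n. c i *\<^sub>R E i x) = 0" and j: "j < n"
    have \<beta>x: "\<beta> x \<noteq> 0" using x by (auto simp: d_def)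
    have "0 = \<alpha> j x (\<Sum>i<n. c i *\<^sub>R E i x)" by (simp add: c \<alpha>_def)
    also have "\<dots> = (\<Sum>i<n. c i * \<alpha> j x (E i x))"
      by (simp add: \<alpha>_def tvec_sum_apply scaleR_fun_def sum_distrib_left sum_subtractf algebra_simps)
    also have "\<dots> = (\<Sum>i<n. if i = j then c i * d x else 0)"
      by (rule sum.cong) (auto simp: dual[OF \<beta>x _ j])
    also have "\<dots> = c j * d x" using j by simp
    finally show "c j = 0" using x by simp
  next
    fix Z assume Z: "Z \<in> VF"
    have "\<forall>i<n. (\<lambda>x. \<alpha> i x (Z x)) \<in> SF"
      unfolding \<alpha>_def by (intro allI impI SF_diff SF_mult vector_field_smooth[OF Z] \<beta> \<kappa>)
    then show "\<exists>a. (\<forall>i<n. a i \<in> SF) \<and> (\<forall>x. d x *\<^sub>R Z x = (\<Sum>i<n. a i x *\<^sub>R E i x))"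
      using expand[OF vector_field_tangent[OF Z]] by (intro exI[of _ "\<lambda>i x. \<alpha> i x (Z x)"]) blast
  qed
  moreover have "d p \<noteq> 0" using nonzero[of p] U(2) R(1) by (auto simp: d_def c_def)
  ultimately show ?thesis using that by blast
qed

lemma tangent_vector_extends:
  assumes "v \<in> TS x"
  obtains Z where "Z \<in> VF" "Z x = v"
proof -
  obtain d n E where E: "local_frame d n E" "d x \<noteq> 0" by (rule local_frame_exists)
  then obtain c where "v = (\<Sum>i<n. c i *\<^sub>R E i x)"
    using assms unfolding local_frame_def by blast
  moreover have "(\<lambda>x. \<Sum>i<n. c i *\<^sub>R E i x) \<in> VF"
    using E(1) by (intro VF_sum VF_scale SF_const) (simp add: local_frame_def)
  ultimately show ?thesis using that by blast
qed

lemma tangent_space_finite_span: "\<exists>B. finite B \<and> TS x \<subseteq> span B"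
proof -
  obtain d n E where E: "local_frame d n E" "d x \<noteq> 0" by (rule local_frame_exists)
  have "TS x \<subseteq> span ((\<lambda>i. E i x) ` {..<n})"
  proof
    fix v assume "v \<in> TS x"
    then obtain c where "v = (\<Sum>i<n. c i *\<^sub>R E i x)"
      using E unfolding local_frame_def by blast
    then show "v \<in> span ((\<lambda>i. E i x) ` {..<n})"
      by (auto intro: span_sum span_scale span_base)
  qed
  then show ?thesis by blast
qed

lemma tangent_eqI: "u \<in> TS x \<Longrightarrow> v \<in> TS x \<Longrightarrow> (\<And>f. f \<in> SF \<Longrightarrow> u f = v f) \<Longrightarrow> u = v"
  by (rule ext) (metis tangent_space_nonsmooth)

subsection \<open>Smooth solutions of linear systems\<close>

text \<open>Gaussian elimination without division. A pivot \<open>G k n\<close> that is nonzero at \<open>p\<close> exists in the last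
  column, since otherwise the last unit vector would solve the homogeneous system. Multiplying the
  other rows by it before subtracting keeps all entries smooth, and the
  factor is collected in the denominator \<open>d\<close>. The rows form an arbitrary finite index set \<open>I\<close>, so
  that the pivot row can be removed without renumbering.\<close>

lemma smooth_linear_system:
  assumes "finite I" "card I = n" "\<And>i j. i \<in> I \<Longrightarrow> j < n \<Longrightarrow> G i j \<in> SF" "\<And>i. i \<in> I \<Longrightarrow> F i \<in> SF"
    and "\<And>c. (\<And>i. i \<in> I \<Longrightarrow> (\<Sum>j<n. G i j p * c j) = 0) \<Longrightarrow> \<forall>j<n. c j = 0"
  shows "\<exists>d\<in>SF. \<exists>s. (\<forall>j<n. s j \<in> SF) \<and> d p \<noteq> 0 \<and>
    (\<forall>x. d x \<noteq> 0 \<longrightarrow> (\<forall>i\<in>I. (\<Sum>j<n. G i j x * (s j x / d x)) = F i x))"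
  using assms
proof (induction n arbitrary: I G F)
  case 0
  then show ?case using SF_const[of 1] by (intro bexI[of _ "\<lambda>_. 1"]) auto
next
  case (Suc n)
  have "\<exists>k\<in>I. G k n p \<noteq> 0"
  proof (rule ccontr)
    assume "\<not> (\<exists>k\<in>I. G k n p \<noteq> 0)"
    then have "(\<Sum>j<Suc n. G i j p * (if j = n then 1 else 0)) = 0" if "i \<in> I" for i
      using that by (simp add: if_distrib cong: if_cong)
    from Suc.prems(5)[OF this] show False by auto
  qed
  then obtain k where k: "k \<in> I" "G k n p \<noteq> 0" by blast
  define G' where "G' i j x = G k n x * G i j x - G i n x * G k j x" for i j x
  define F' where "F' i x = G k n x * F i x - G i n x * F k x" for i x
  have "\<exists>d\<in>SF. \<exists>s. (\<forall>j<n. s j \<in> SF) \<and> d p \<noteq> 0 \<and>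
    (\<forall>x. d x \<noteq> 0 \<longrightarrow> (\<forall>i\<in>I - {k}. (\<Sum>j<n. G' i j x * (s j x / d x)) = F' i x))"
  proof (rule Suc.IH)
    show "finite (I - {k})" "card (I - {k}) = n" using Suc.prems(1,2) k(1) by auto
    show "G' i j \<in> SF" if "i \<in> I - {k}" "j < n" for i j
      unfolding G'_def using that k(1) by (intro SF_diff SF_mult Suc.prems(3)) auto
    show "F' i \<in> SF" if "i \<in> I - {k}" for i
      unfolding F'_def using that k(1) by (intro SF_diff SF_mult Suc.prems(3,4)) auto
    fix c assume c: "\<And>i. i \<in> I - {k} \<Longrightarrow> (\<Sum>j<n. G' i j p * c j) = 0"
    define e where "e = - (\<Sum>j<n. G k j p * c j) / G k n p"
    have "(\<Sum>j<Suc n. G i j p * (c(n := e)) j) = 0" if i: "i \<in> I" for i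
    proof (cases "i = k")
      case True
      then show ?thesis using k(2) by (simp add: e_def)
    next
      case False
      have "G k n p * (\<Sum>j<Suc n. G i j p * (c(n := e)) j) =
          G k n p * (\<Sum>j<n. G i j p * c j) - G i n p * (\<Sum>j<n. G k j p * c j)"
        using k(2) by (simp add: e_def right_diff_distrib)
      also have "\<dots> = (\<Sum>j<n. G' i j p * c j)"
        by (simp add: G'_def sum_distrib_left sum_subtractf algebra_simps)
      finally show ?thesis using c i False k(2) by simp
    qed
    from Suc.prems(5)[OF this] show "\<forall>j<n. c j = 0" by (auto simp: less_Suc_eq)
  qed
  then obtain d s where d: "d \<in> SF" "d p \<noteq> 0" and s: "\<And>j. j < n \<Longrightarrow> s j \<in> SF"
    and sol: "\<And>x i. d x \<noteq> 0 \<Longrightarrow> i \<in> I - {k} \<Longrightarrow> (\<Sum>j<n. G' i j x * (s j x / d x)) = F' i x"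
    by blast
  define t where "t j x = (if j = n then d x * F k x - (\<Sum>j<n. G k j x * s j x) else G k n x * s j x)" for j x
  have row: "G k j \<in> SF" if "j < Suc n" for j using Suc.prems(3) k(1) that by blast
  show ?case
  proof (intro bexI[of _ "\<lambda>x. G k n x * d x"] exI[of _ t] conjI allI impI ballI)
    show "(\<lambda>x. G k n x * d x) \<in> SF" by (intro SF_mult row d) simp
    show "t j \<in> SF" if "j < Suc n" for j
    proof (cases "j = n")
      case True
      then show ?thesis unfolding t_def
        using s row by (auto intro!: SF_diff SF_mult SF_sum d Suc.prems(4) k(1))
    next
      case False
      then show ?thesis unfolding t_def using that s row by (auto intro!: SF_mult)
    qed
    show "G k n p * d p \<noteq> 0" using k d by simp
  next
    fix x i assume x: "G k n x * d x \<noteq> 0" and i: "i \<in> I"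
    define w where "w j = s j x / d x" for j
    have w: "t j x / (G k n x * d x) = w j" if "j < n" for j
      using that x by (simp add: t_def w_def)
    have wn: "t n x / (G k n x * d x) = (F k x - (\<Sum>j<n. G k j x * w j)) / G k n x"
    proof -
      have "(\<Sum>j<n. G k j x * w j) = (\<Sum>j<n. G k j x * s j x) / d x"
        by (simp add: w_def sum_divide_distrib)
      then show ?thesis using x by (simp add: t_def field_simps)
    qed
    have *: "(\<Sum>j<Suc n. G i j x * (t j x / (G k n x * d x))) =
        (\<Sum>j<n. G i j x * w j) + G i n x * ((F k x - (\<Sum>j<n. G k j x * w j)) / G k n x)"
      by (simp add: w wn del: times_divide_eq_right divide_divide_eq_left)
    show "(\<Sum>j<Suc n. G i j x * (t j x / (G k n x * d x))) = F i x"
    proof (cases "i = k")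
      case True
      then show ?thesis unfolding * using x by simp
    next
      case False
      have "G k n x * (\<Sum>j<n. G i j x * w j) - G i n x * (\<Sum>j<n. G k j x * w j) = (\<Sum>j<n. G' i j x * w j)"
        by (simp add: G'_def sum_distrib_left sum_subtractf algebra_simps)
      also have "\<dots> = F' i x" using sol[of x i] x i False by (simp add: w_def)
      finally have "G k n x * (\<Sum>j<n. G i j x * w j) + G i n x * (F k x - (\<Sum>j<n. G k j x * w j)) =
          G k n x * F i x"
        by (simp add: F'_def right_diff_distrib)
      moreover have "G k n x * (S + g * (r / G k n x)) = G k n x * S + g * r" for S g r
        using x by (simp add: distrib_left)
      ultimately have "G k n x * ((\<Sum>j<n. G i j x * w j)
          + G i n x * ((F k x - (\<Sum>j<n. G k j x * w j)) / G k n x)) = G k n x * F i x"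
        by (simp only:)
      then show ?thesis unfolding * using x by simp
    qed
  qed
qed

subsection \<open>Tensors\<close>

lemma linear_on_tangent_rules:
  assumes "linear_on_tangent A x L"
  shows linear_on_tangent_add: "u \<in> TS x \<Longrightarrow> v \<in> TS x \<Longrightarrow> L (u + v) = L u + L v"
    and linear_on_tangent_scale: "v \<in> TS x \<Longrightarrow> L (c *\<^sub>R v) = c *\<^sub>R L v"
    and linear_on_tangent_zero: "L 0 = 0"
    and linear_on_tangent_minus: "v \<in> TS x \<Longrightarrow> L (- v) = - L v"
    and linear_on_tangent_diff: "u \<in> TS x \<Longrightarrow> v \<in> TS x \<Longrightarrow> L (u - v) = L u - L v"
    and linear_on_tangent_sum: "(\<And>i. i \<in> I \<Longrightarrow> V i \<in> TS x) \<Longrightarrow> L (\<Sum>i\<in>I. V i) = (\<Sum>i\<in>I. L (V i))"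
proof -
  show add: "L (u + v) = L u + L v" if "u \<in> TS x" "v \<in> TS x" for u v
    using assms that by (simp add: linear_on_tangent_def)
  show scale: "L (c *\<^sub>R v) = c *\<^sub>R L v" if "v \<in> TS x" for c v
    using assms that by (simp add: linear_on_tangent_def)
  show zero: "L 0 = 0" using scale[OF tangent_space_closed(4), of 0] by simp
  show minus: "L (- v) = - L v" if "v \<in> TS x" for v using scale[OF that, of "-1"] by simp
  show "L (u - v) = L u - L v" if "u \<in> TS x" "v \<in> TS x" for u v
    using add[OF that(1) tangent_space_closed(6)[OF that(2)]] minus[OF that(2)] by simp
  show "L (\<Sum>i\<in>I. V i) = (\<Sum>i\<in>I. L (V i))" if "\<And>i. i \<in> I \<Longrightarrow> V i \<in> TS x"
    using that
  proof (induction I rule: infinite_finite_induct)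
    case (insert i I)
    have "sum V I \<in> TS x" by (rule tangent_space_closed(3)) (use insert.prems in blast)
    then have "L (V i + sum V I) = L (V i) + L (sum V I)" using add insert.prems by blast
    then show ?case using insert by (simp del: plus_fun_apply)
  qed (simp_all add: zero)
qed

lemma lie_bracket_antisym: "lie_bracket X Y x = - lie_bracket Y X x"
  by (simp add: lie_bracket_def fun_eq_iff)

lemma lie_bracket_add:
  assumes X: "X \<in> VF" and Y: "Y \<in> VF" and Z: "Z \<in> VF"
  shows lie_bracket_add_left: "lie_bracket (X + Y) Z x = lie_bracket X Z x + lie_bracket Y Z x"
    and lie_bracket_add_right: "lie_bracket Z (X + Y) x = lie_bracket Z X x + lie_bracket Z Y x"
proof -
  show "lie_bracket (X + Y) Z x = lie_bracket X Z x + lie_bracket Y Z x"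
  proof (rule tangent_eqI)
    show "lie_bracket (X + Y) Z x f = (lie_bracket X Z x + lie_bracket Y Z x) f" if "f \<in> SF" for f
      using tangent_space_add[OF vector_field_tangent[OF Z] vector_field_smooth[OF X that]
          vector_field_smooth[OF Y that]]
      by (simp add: lie_bracket_def)
    show "lie_bracket (X + Y) Z x \<in> TS x"
      by (intro vector_field_tangent VF_lie_bracket VF_add assms)
    show "lie_bracket X Z x + lie_bracket Y Z x \<in> TS x"
      by (intro tangent_space_closed vector_field_tangent VF_lie_bracket assms)
  qed
  then show "lie_bracket Z (X + Y) x = lie_bracket Z X x + lie_bracket Z Y x"
    using lie_bracket_antisym[of Z] by simp
qed

lemma lie_bracket_scale:
  assumes f: "f \<in> SF" and X: "X \<in> VF" and Y: "Y \<in> VF"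
  shows lie_bracket_scale_left:
      "lie_bracket (\<lambda>x. f x *\<^sub>R X x) Y x = f x *\<^sub>R lie_bracket X Y x - Y x f *\<^sub>R X x"
    and lie_bracket_scale_right:
      "lie_bracket Y (\<lambda>x. f x *\<^sub>R X x) x = f x *\<^sub>R lie_bracket Y X x + Y x f *\<^sub>R X x"
proof -
  show left: "lie_bracket (\<lambda>x. f x *\<^sub>R X x) Y x = f x *\<^sub>R lie_bracket X Y x - Y x f *\<^sub>R X x"
  proof (rule tangent_eqI)
    show "lie_bracket (\<lambda>x. f x *\<^sub>R X x) Y x h = (f x *\<^sub>R lie_bracket X Y x - Y x f *\<^sub>R X x) h"
      if "h \<in> SF" for h
      using tangent_space_mult[OF vector_field_tangent[OF Y] f vector_field_smooth[OF X that]]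
      by (simp add: lie_bracket_def scaleR_fun_def algebra_simps)
    show "lie_bracket (\<lambda>x. f x *\<^sub>R X x) Y x \<in> TS x"
      by (intro vector_field_tangent VF_lie_bracket VF_scale assms)
    show "f x *\<^sub>R lie_bracket X Y x - Y x f *\<^sub>R X x \<in> TS x"
      by (intro tangent_space_closed vector_field_tangent VF_lie_bracket assms)
  qed
  show "lie_bracket Y (\<lambda>x. f x *\<^sub>R X x) x = f x *\<^sub>R lie_bracket Y X x + Y x f *\<^sub>R X x"
    using left lie_bracket_antisym[of Y] by simp
qed

end

section \<open>Connections determined by a nondegenerate form, a torsion and a non-metricity\<close>

locale nondegenerate_form = manifold +
  fixes h :: "'a \<Rightarrow> 'a tvec \<Rightarrow> 'a tvec \<Rightarrow> real"
  assumes tensor: "tensor_0_2 A h"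
    and form_sym: "u \<in> TS x \<Longrightarrow> v \<in> TS x \<Longrightarrow> h x u v = h x v u"
    and nondegenerate: "u \<in> TS x \<Longrightarrow> (\<And>w. w \<in> TS x \<Longrightarrow> h x u w = 0) \<Longrightarrow> u = 0"
begin

lemma form_linear:
  assumes "w \<in> TS x"
  shows form_linear_left: "linear_on_tangent A x (\<lambda>v. h x v w)"
    and form_linear_right: "linear_on_tangent A x (\<lambda>v. h x w v)"
  using tensor assms unfolding tensor_0_2_def by auto

lemmas form_left = linear_on_tangent_rules[OF form_linear_left]
lemmas form_right = linear_on_tangent_rules[OF form_linear_right]

lemma form_smooth: "X \<in> VF \<Longrightarrow> Y \<in> VF \<Longrightarrow> (\<lambda>x. h x (X x) (Y x)) \<in> SF"
  using tensor unfolding tensor_0_2_def by blast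

lemma form_determines_tangent:
  assumes u: "u \<in> TS x" and v: "v \<in> TS x" and eq: "\<And>Z. Z \<in> VF \<Longrightarrow> h x u (Z x) = h x v (Z x)"
  shows "u = v"
proof -
  have "h x (u - v) w = 0" if w: "w \<in> TS x" for w
  proof -
    obtain Z where "Z \<in> VF" "Z x = w" by (rule tangent_vector_extends[OF w])
    then have "h x u w = h x v w" using eq by blast
    then show ?thesis using form_left(5)[OF w u v] by simp
  qed
  then have "u - v = 0" by (rule nondegenerate[OF tangent_space_closed(5)[OF u v]])
  then show ?thesis by simp
qed

text \<open>Nondegeneracy makes the representing vector unique at each point. In a local frame it solves a linear
  system whose matrix is the Gram matrix of \<open>h\<close>; this matrix is nonsingular, so the solution exists
  and has smooth coordinates up to a denominator. A solution tested on the frame works for every field \<open>Z\<close>,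
  because \<open>d Z\<close> is a combination of the frame with smooth coefficients and \<open>F\<close> is linear over
  the smooth functions.\<close>

lemma form_represents:
  assumes smooth: "\<And>Z. Z \<in> VF \<Longrightarrow> F Z \<in> SF"
    and add: "\<And>Y Z. Y \<in> VF \<Longrightarrow> Z \<in> VF \<Longrightarrow> F (Y + Z) = (\<lambda>x. F Y x + F Z x)"
    and scale: "\<And>f Z. f \<in> SF \<Longrightarrow> Z \<in> VF \<Longrightarrow> F (\<lambda>x. f x *\<^sub>R Z x) = (\<lambda>x. f x * F Z x)"
  shows "\<exists>W\<in>VF. \<forall>Z\<in>VF. \<forall>x. h x (W x) (Z x) = F Z x"
proof -
  have F_sum: "F (\<lambda>x. \<Sum>i<n. a i x *\<^sub>R E i x) = (\<lambda>x. \<Sum>i<n. a i x * F (E i) x)"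
    if "\<forall>i<n. a i \<in> SF" "\<forall>i<n. E i \<in> VF" for n a and E :: "nat \<Rightarrow> 'a vfield"
    using that
  proof (induction n)
    case 0
    have "(\<lambda>x. \<Sum>i\<in>({} :: nat set). E i x) \<in> VF" by (rule VF_sum) simp
    from scale[OF SF_const[of 0] this] show ?case by (simp only: sum.empty scaleR_zero_right lessThan_0 mult_zero_left)
  next
    case (Suc n)
    have "(\<lambda>x. \<Sum>i<Suc n. a i x *\<^sub>R E i x) = (\<lambda>x. \<Sum>i<n. a i x *\<^sub>R E i x) + (\<lambda>x. a n x *\<^sub>R E n x)"
      by (simp add: fun_eq_iff)
    moreover have "F ((\<lambda>x. \<Sum>i<n. a i x *\<^sub>R E i x) + (\<lambda>x. a n x *\<^sub>R E n x)) =
        (\<lambda>x. F (\<lambda>x. \<Sum>i<n. a i x *\<^sub>R E i x) x + F (\<lambda>x. a n x *\<^sub>R E n x) x)"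
      by (rule add; intro VF_sum VF_scale; use Suc.prems in simp)
    moreover have "F (\<lambda>x. a n x *\<^sub>R E n x) = (\<lambda>x. a n x * F (E n) x)"
      using Suc.prems by (intro scale) simp_all
    moreover have "F (\<lambda>x. \<Sum>i<n. a i x *\<^sub>R E i x) = (\<lambda>x. \<Sum>i<n. a i x * F (E i) x)"
      using Suc.prems by (intro Suc.IH) simp_all
    ultimately show ?case by (simp only: sum.lessThan_Suc)
  qed
  define represents where "represents x w \<longleftrightarrow> w \<in> TS x \<and> (\<forall>Z\<in>VF. h x w (Z x) = F Z x)" for x w
  have unique: "w = w'" if "represents x w" "represents x w'" for x w w'
    using that form_determines_tangent unfolding represents_def by metis
  have loc: "\<exists>D\<in>SF. \<exists>(n :: nat) E s. D p \<noteq> 0 \<and> (\<forall>j<n. E j \<in> VF \<and> s j \<in> SF) \<and>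
      (\<forall>x. D x \<noteq> 0 \<longrightarrow> represents x (\<Sum>j<n. (s j x / D x) *\<^sub>R E j x))" for p
  proof -
    obtain d n E where dE: "local_frame d n E" "d p \<noteq> 0" by (rule local_frame_exists)
    then have d: "d \<in> SF" and E: "\<And>i. i < n \<Longrightarrow> E i \<in> VF" unfolding local_frame_def by auto
    have T: "\<And>i x. i < n \<Longrightarrow> E i x \<in> TS x" using E vector_field_tangent by blast
    have lin: "h x (\<Sum>j<n. c j *\<^sub>R E j x) w = (\<Sum>j<n. h x (E j x) w * c j)" if "w \<in> TS x" for x w c
      by (subst form_left(6)[OF that]) (auto intro!: sum.cong tangent_space_closed T
          simp: form_left(2)[OF that T])
    have lin_right: "h x w (\<Sum>j<n. c j *\<^sub>R E j x) = (\<Sum>j<n. c j * h x w (E j x))" if "w \<in> TS x" for x w c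
      by (subst form_right(6)[OF that]) (auto intro!: sum.cong tangent_space_closed T
          simp: form_right(2)[OF that T])
    have "\<exists>d'\<in>SF. \<exists>s. (\<forall>j<n. s j \<in> SF) \<and> d' p \<noteq> 0 \<and> (\<forall>x. d' x \<noteq> 0 \<longrightarrow>
        (\<forall>i\<in>{..<n}. (\<Sum>j<n. h x (E j x) (E i x) * (s j x / d' x)) = F (E i) x))"
    proof (rule smooth_linear_system)
      fix c assume c: "\<And>i. i \<in> {..<n} \<Longrightarrow> (\<Sum>j<n. h p (E j p) (E i p) * c j) = 0"
      have "h p (\<Sum>j<n. c j *\<^sub>R E j p) w = 0" if w: "w \<in> TS p" for w
      proof -
        obtain a where a: "w = (\<Sum>i<n. a i *\<^sub>R E i p)"
          using dE w unfolding local_frame_def by blast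
        have V: "(\<Sum>j<n. c j *\<^sub>R E j p) \<in> TS p" by (auto intro!: tangent_space_closed T)
        have "h p (\<Sum>j<n. c j *\<^sub>R E j p) w = (\<Sum>i<n. a i * h p (\<Sum>j<n. c j *\<^sub>R E j p) (E i p))"
          unfolding a by (rule lin_right[OF V])
        also have "\<dots> = 0" using c by (intro sum.neutral) (simp add: lin[OF T])
        finally show ?thesis .
      qed
      then have "(\<Sum>j<n. c j *\<^sub>R E j p) = 0"
        by (intro nondegenerate) (auto intro!: tangent_space_closed T)
      then show "\<forall>j<n. c j = 0" using dE unfolding local_frame_def by blast
    qed (auto intro: form_smooth smooth E)
    then obtain d' s where d': "d' \<in> SF" "d' p \<noteq> 0" and s: "\<And>j. j < n \<Longrightarrow> s j \<in> SF"
      and sol: "\<And>x i. d' x \<noteq> 0 \<Longrightarrow> i < n \<Longrightarrow> (\<Sum>j<n. h x (E j x) (E i x) * (s j x / d' x)) = F (E i) x"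
      by blast
    have rep: "represents x (\<Sum>j<n. (d x * s j x / (d x * d' x)) *\<^sub>R E j x)" if x: "d x * d' x \<noteq> 0" for x
    proof -
      let ?w = "\<Sum>j<n. (d x * s j x / (d x * d' x)) *\<^sub>R E j x"
      have w: "?w \<in> TS x" by (auto intro!: tangent_space_closed T)
      have frame: "h x ?w (E i x) = F (E i) x" if "i < n" for i
        using sol[of x i] that x by (simp add: lin[OF T[OF that]])
      have "h x ?w (Z x) = F Z x" if Z: "Z \<in> VF" for Z
      proof -
        obtain a where a: "\<forall>i<n. a i \<in> SF" "\<And>x. d x *\<^sub>R Z x = (\<Sum>i<n. a i x *\<^sub>R E i x)"
          using dE Z unfolding local_frame_def by blast
        have "d x * F Z x = F (\<lambda>x. d x *\<^sub>R Z x) x" by (simp add: scale[OF d Z])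
        also have "\<dots> = (\<Sum>i<n. a i x * F (E i) x)" using F_sum[OF a(1)] E by (simp add: a(2))
        also have "\<dots> = (\<Sum>i<n. a i x * h x ?w (E i x))"
          by (intro sum.cong refl) (simp only: frame lessThan_iff)
        also have "\<dots> = h x ?w (\<Sum>i<n. a i x *\<^sub>R E i x)"
          by (rule lin_right[OF w, symmetric])
        also have "\<dots> = d x * h x ?w (Z x)"
          unfolding a(2)[symmetric] using form_right(2)[OF w vector_field_tangent[OF Z]] by simp
        finally show ?thesis using x by simp
      qed
      then show "represents x ?w" using w unfolding represents_def by blast
    qed
    show ?thesis
    proof (intro bexI exI conjI)
      show "(\<lambda>x. d x * d' x) \<in> SF" by (rule SF_mult[OF d d'(1)])
      show "d p * d' p \<noteq> 0" using dE(2) d'(2) by simp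
      show "\<forall>j<n. E j \<in> VF \<and> (\<lambda>x. d x * s j x) \<in> SF" using E SF_mult[OF d s] by blast
      show "\<forall>x. d x * d' x \<noteq> 0 \<longrightarrow> represents x (\<Sum>j<n. (d x * s j x / (d x * d' x)) *\<^sub>R E j x)"
        using rep by blast
    qed
  qed
  define W where "W x = (SOME w. represents x w)" for x
  have W: "represents x (W x)" for x
    unfolding W_def using loc[of x] someI[of "represents x"] by meson
  have "W \<in> VF"
  proof (rule vector_fieldI)
    show "W x \<in> TS x" for x using W unfolding represents_def by blast
    fix f assume f: "f \<in> SF"
    show "(\<lambda>x. W x f) \<in> SF"
    proof (rule smooth_function_local_quotient)
      fix p
      from loc[of p] obtain D and n :: nat and E s where D: "D \<in> SF" "D p \<noteq> 0"
        and Es: "\<forall>j<n. E j \<in> VF \<and> s j \<in> SF"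
        and rep: "\<forall>x. D x \<noteq> 0 \<longrightarrow> represents x (\<Sum>j<n. (s j x / D x) *\<^sub>R E j x)"
        by blast
      have "W x f = (\<Sum>j<n. s j x * E j x f) / D x" if "D x \<noteq> 0" for x
      proof -
        have "W x = (\<Sum>j<n. (s j x / D x) *\<^sub>R E j x)"
          by (rule unique[OF W]) (use rep that in blast)
        then have "W x f = (\<Sum>j<n. (s j x / D x) *\<^sub>R E j x) f" by (rule fun_cong)
        also have "\<dots> = (\<Sum>j<n. s j x * E j x f / D x)"
          unfolding tvec_sum_apply scaleR_fun_def by simp
        finally show ?thesis by (simp add: sum_divide_distrib)
      qed
      moreover have "(\<lambda>x. \<Sum>j<n. s j x * E j x f) \<in> SF"
        by (rule SF_sum, rule SF_mult[OF _ vector_field_smooth[OF _ f]]) (use Es in simp_all)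
      ultimately show "\<exists>s\<in>SF. \<exists>d\<in>SF. d p \<noteq> 0 \<and> (\<forall>x. d x \<noteq> 0 \<longrightarrow> W x f = s x / d x)"
        using D by (intro bexI[of _ "\<lambda>x. \<Sum>j<n. s j x * E j x f"] bexI[of _ D] conjI allI impI)
    qed
  qed
  then show ?thesis using W unfolding represents_def by blast
qed

end

locale koszul = nondegenerate_form +
  fixes T :: "'a \<Rightarrow> 'a tvec \<Rightarrow> 'a tvec \<Rightarrow> 'a tvec"
    and Q :: "'a \<Rightarrow> 'a tvec \<Rightarrow> 'a tvec \<Rightarrow> 'a tvec \<Rightarrow> real"
  assumes torsion_T: "torsion_tensor A T"
    and non_metricity_Q: "non_metricity_tensor A Q"
begin

lemma torsion_field: "X \<in> VF \<Longrightarrow> Y \<in> VF \<Longrightarrow> (\<lambda>x. T x (X x) (Y x)) \<in> VF"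
  using torsion_T unfolding torsion_tensor_def tensor_1_2_def by blast

lemma torsion_tangent: "X \<in> VF \<Longrightarrow> Y \<in> VF \<Longrightarrow> T x (X x) (Y x) \<in> TS x"
  using vector_field_tangent[OF torsion_field] .

lemma torsion_antisym: "u \<in> TS x \<Longrightarrow> v \<in> TS x \<Longrightarrow> T x u v = - T x v u"
  using torsion_T unfolding torsion_tensor_def by blast

lemma torsion_linear:
  "u \<in> TS x \<Longrightarrow> linear_on_tangent A x (\<lambda>v. T x u v)"
  "u \<in> TS x \<Longrightarrow> linear_on_tangent A x (\<lambda>v. T x v u)"
  using torsion_T unfolding torsion_tensor_def tensor_1_2_def by blast+

lemma non_metricity_linear:
  "u \<in> TS x \<Longrightarrow> w \<in> TS x \<Longrightarrow> linear_on_tangent A x (\<lambda>v. Q x v u w)"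
  "u \<in> TS x \<Longrightarrow> w \<in> TS x \<Longrightarrow> linear_on_tangent A x (\<lambda>v. Q x u v w)"
  "u \<in> TS x \<Longrightarrow> w \<in> TS x \<Longrightarrow> linear_on_tangent A x (\<lambda>v. Q x u w v)"
  using non_metricity_Q unfolding non_metricity_tensor_def tensor_0_3_def by blast+

lemma non_metricity_sym:
  "w \<in> TS x \<Longrightarrow> u \<in> TS x \<Longrightarrow> v \<in> TS x \<Longrightarrow> Q x w u v = Q x w v u"
  using non_metricity_Q unfolding non_metricity_tensor_def by blast

lemma non_metricity_smooth:
  "X \<in> VF \<Longrightarrow> Y \<in> VF \<Longrightarrow> Z \<in> VF \<Longrightarrow> (\<lambda>x. Q x (X x) (Y x) (Z x)) \<in> SF"
  using non_metricity_Q unfolding non_metricity_tensor_def tensor_0_3_def by blast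

text \<open>Twice the value that \<open>h(\<nabla>\<^sub>X Y, Z)\<close> must have, as \<open>koszul_formula\<close> shows.\<close>

definition koszul_form :: "'a vfield \<Rightarrow> 'a vfield \<Rightarrow> 'a vfield \<Rightarrow> 'a \<Rightarrow> real" where
  "koszul_form X Y Z = (\<lambda>x.
     X x (\<lambda>y. h y (Y y) (Z y)) + Y x (\<lambda>y. h y (X y) (Z y)) - Z x (\<lambda>y. h y (X y) (Y y))
     + h x (lie_bracket X Y x) (Z x) - h x (lie_bracket X Z x) (Y x) - h x (lie_bracket Y Z x) (X x)
     - Q x (X x) (Y x) (Z x) - Q x (Y x) (X x) (Z x) + Q x (Z x) (X x) (Y x)
     + h x (T x (X x) (Y x)) (Z x) - h x (T x (X x) (Z x)) (Y x) - h x (T x (Y x) (Z x)) (X x))"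

lemma koszul_form_smooth:
  assumes "X \<in> VF" "Y \<in> VF" "Z \<in> VF"
  shows "koszul_form X Y Z \<in> SF"
proof -
  note s = assms VF_lie_bracket torsion_field
  show ?thesis unfolding koszul_form_def
    by (rule SF_add SF_diff vector_field_smooth[of X] vector_field_smooth[of Y]
        vector_field_smooth[of Z] form_smooth non_metricity_smooth s)+
qed

lemma form_sym_fields: "X \<in> VF \<Longrightarrow> Y \<in> VF \<Longrightarrow> (\<lambda>y. h y (X y) (Y y)) = (\<lambda>y. h y (Y y) (X y))"
  by (intro ext form_sym vector_field_tangent)

text \<open>This identity says that the connection to be defined has non-metricity \<open>Q\<close>, and the next one that
  it has torsion \<open>T\<close>. They also transfer linearity between the arguments: additivity and scaling are
  computed by hand in the last argument only, the middle one follows from this identity, and the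
  first one from the middle one by the next.\<close>

lemma koszul_form_metric:
  assumes X: "X \<in> VF" and Y: "Y \<in> VF" and Z: "Z \<in> VF"
  shows "koszul_form X Y Z x + koszul_form X Z Y x =
    2 * X x (\<lambda>y. h y (Y y) (Z y)) - 2 * Q x (X x) (Y x) (Z x)"
proof -
  note t = vector_field_tangent[OF X] vector_field_tangent[OF Y] vector_field_tangent[OF Z]
  have "lie_bracket Z Y x = - lie_bracket Y Z x" by (rule lie_bracket_antisym)
  moreover have "T x (Z x) (Y x) = - T x (Y x) (Z x)" by (intro torsion_antisym t)
  moreover note form_sym_fields[OF Z Y] form_sym_fields[OF Z X] form_sym_fields[OF Y X]
    form_left(4)[OF t(1) vector_field_tangent[OF VF_lie_bracket[OF Y Z]]]
    form_left(4)[OF t(1) torsion_tangent[OF Y Z]]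
    non_metricity_sym[OF t(1,3,2)] non_metricity_sym[OF t(2,1,3)] non_metricity_sym[OF t(3,1,2)]
  ultimately show ?thesis unfolding koszul_form_def by simp
qed

lemma koszul_form_torsion:
  assumes X: "X \<in> VF" and Y: "Y \<in> VF" and Z: "Z \<in> VF"
  shows "koszul_form X Y Z x - koszul_form Y X Z x =
    2 * h x (lie_bracket X Y x) (Z x) + 2 * h x (T x (X x) (Y x)) (Z x)"
proof -
  note t = vector_field_tangent[OF X] vector_field_tangent[OF Y] vector_field_tangent[OF Z]
  have "lie_bracket Y X x = - lie_bracket X Y x" by (rule lie_bracket_antisym)
  moreover have "T x (Y x) (X x) = - T x (X x) (Y x)" by (intro torsion_antisym t)
  moreover note form_sym_fields[OF Y X]
    form_left(4)[OF t(3) vector_field_tangent[OF VF_lie_bracket[OF X Y]]]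
    form_left(4)[OF t(3) torsion_tangent[OF X Y]]
    non_metricity_sym[OF t(3,1,2)]
  ultimately show ?thesis unfolding koszul_form_def by simp
qed

lemma koszul_form_add:
  assumes X: "X \<in> VF" and Y: "Y \<in> VF" and Z: "Z \<in> VF" and W: "W \<in> VF"
  shows "koszul_form X Y (Z + W) = (\<lambda>x. koszul_form X Y Z x + koszul_form X Y W x)"
proof
  fix x
  note t = vector_field_tangent
  have e: "(Z + W) y = Z y + W y" for y by simp
  have 1: "(\<lambda>y. h y (V y) ((Z + W) y)) = (\<lambda>y. h y (V y) (Z y) + h y (V y) (W y))" if "V \<in> VF" for V
    unfolding e by (intro ext form_right(1) t that Z W)
  have 2: "U x (\<lambda>y. h y (V y) ((Z + W) y)) = U x (\<lambda>y. h y (V y) (Z y)) + U x (\<lambda>y. h y (V y) (W y))"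
    if "U \<in> VF" "V \<in> VF" for U V
    unfolding 1[OF that(2)] by (rule tangent_space_add[OF t[OF that(1)]]; intro form_smooth that Z W)
  have 3: "h x (V x) ((Z + W) x) = h x (V x) (Z x) + h x (V x) (W x)" if "V \<in> VF" for V
    using fun_cong[OF 1[OF that], of x] .
  have 4: "h x (lie_bracket V (Z + W) x) (U x) = h x (lie_bracket V Z x) (U x) + h x (lie_bracket V W x) (U x)"
    if "U \<in> VF" "V \<in> VF" for U V
    unfolding lie_bracket_add_right[OF Z W that(2)]
    by (intro form_left(1) t VF_lie_bracket that Z W)
  have 5: "h x (T x (V x) ((Z + W) x)) (U x) = h x (T x (V x) (Z x)) (U x) + h x (T x (V x) (W x)) (U x)"
    if "U \<in> VF" "V \<in> VF" for U V
    unfolding e linear_on_tangent_add[OF torsion_linear(1)[OF t[OF that(2)]] t[OF Z] t[OF W]]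
    by (intro form_left(1) t[OF that(1)] torsion_tangent that Z W)
  have 6: "Q x (U x) (V x) ((Z + W) x) = Q x (U x) (V x) (Z x) + Q x (U x) (V x) (W x)"
    if "U \<in> VF" "V \<in> VF" for U V
    unfolding e by (intro linear_on_tangent_add[OF non_metricity_linear(3)] t that Z W)
  have 7: "Q x ((Z + W) x) (U x) (V x) = Q x (Z x) (U x) (V x) + Q x (W x) (U x) (V x)"
    if "U \<in> VF" "V \<in> VF" for U V
    unfolding e by (intro linear_on_tangent_add[OF non_metricity_linear(1)] t that Z W)
  have 8: "(Z + W) x f = Z x f + W x f" for f by simp
  show "koszul_form X Y (Z + W) x = koszul_form X Y Z x + koszul_form X Y W x"
    unfolding koszul_form_def 2[OF X Y] 2[OF Y X] 3[OF VF_lie_bracket[OF X Y]] 3[OF torsion_field[OF X Y]]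
      4[OF Y X] 4[OF X Y] 5[OF Y X] 5[OF X Y] 6[OF X Y] 6[OF Y X] 7[OF X Y] 8
    by (simp only: algebra_simps)
qed

text \<open>The derivatives of \<open>f\<close> in the terms \<open>X(h(Y, f Z))\<close> and \<open>Y(h(X, f Z))\<close> cancel against those
  in the brackets \<open>[X, f Z]\<close> and \<open>[Y, f Z]\<close>.\<close>

lemma koszul_form_scale:
  assumes X: "X \<in> VF" and Y: "Y \<in> VF" and Z: "Z \<in> VF" and f: "f \<in> SF"
  shows "koszul_form X Y (\<lambda>x. f x *\<^sub>R Z x) = (\<lambda>x. f x * koszul_form X Y Z x)"
proof
  fix x
  note t = vector_field_tangent
  have 1: "h y (V y) (f y *\<^sub>R Z y) = f y * h y (V y) (Z y)" if "V \<in> VF" for V y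
    using form_right(2)[OF t[OF that] t[OF Z]] by simp
  have 2: "U x (\<lambda>y. h y (V y) (f y *\<^sub>R Z y)) = f x * U x (\<lambda>y. h y (V y) (Z y)) + h x (V x) (Z x) * U x f"
    if "U \<in> VF" "V \<in> VF" for U V
    unfolding 1[OF that(2)] by (rule tangent_space_mult[OF t[OF that(1)] f]; intro form_smooth that Z)
  have 4: "h x (lie_bracket V (\<lambda>x. f x *\<^sub>R Z x) x) (U x) = f x * h x (lie_bracket V Z x) (U x) + V x f * h x (Z x) (U x)"
    if U: "U \<in> VF" and V: "V \<in> VF" for U V
    unfolding lie_bracket_scale_right[OF f Z V]
    using form_left(1)[OF t[OF U] tangent_space_closed(2)[OF t[OF VF_lie_bracket[OF V Z]]] tangent_space_closed(2)[OF t[OF Z]]]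
      form_left(2)[OF t[OF U] t[OF VF_lie_bracket[OF V Z]]] form_left(2)[OF t[OF U] t[OF Z]] by simp
  have 5: "h x (T x (V x) (f x *\<^sub>R Z x)) (U x) = f x * h x (T x (V x) (Z x)) (U x)"
    if "U \<in> VF" "V \<in> VF" for U V
    using linear_on_tangent_scale[OF torsion_linear(1)[OF t[OF that(2)]] t[OF Z]]
      form_left(2)[OF t[OF that(1)] torsion_tangent[OF that(2) Z]] by simp
  have 6: "Q x (U x) (V x) (f x *\<^sub>R Z x) = f x * Q x (U x) (V x) (Z x)"
    if "U \<in> VF" "V \<in> VF" for U V
    using linear_on_tangent_scale[OF non_metricity_linear(3)[OF t[OF that(1)] t[OF that(2)]] t[OF Z]] by simp
  have 7: "Q x (f x *\<^sub>R Z x) (U x) (V x) = f x * Q x (Z x) (U x) (V x)"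
    if "U \<in> VF" "V \<in> VF" for U V
    using linear_on_tangent_scale[OF non_metricity_linear(1)[OF t[OF that(1)] t[OF that(2)]] t[OF Z]] by simp
  have 8: "(f x *\<^sub>R Z x) k = f x * Z x k" for k by (simp add: scaleR_fun_def)
  have 9: "h x (Y x) (Z x) = h x (Z x) (Y x)" "h x (X x) (Z x) = h x (Z x) (X x)"
    by (intro form_sym t X Y Z)+
  show "koszul_form X Y (\<lambda>x. f x *\<^sub>R Z x) x = f x * koszul_form X Y Z x"
    unfolding koszul_form_def 2[OF X Y] 2[OF Y X] 1[OF VF_lie_bracket[OF X Y]] 1[OF torsion_field[OF X Y]]
      4[OF Y X] 4[OF X Y] 5[OF Y X] 5[OF X Y] 6[OF X Y] 6[OF Y X] 7[OF X Y] 8 9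
    by (simp only: algebra_simps)
qed

lemma koszul_form_add_middle:
  assumes X: "X \<in> VF" and Y: "Y \<in> VF" and Z: "Z \<in> VF" and V: "V \<in> VF"
  shows "koszul_form Z (X + Y) V x = koszul_form Z X V x + koszul_form Z Y V x"
proof -
  note t = vector_field_tangent
  have e: "(X + Y) y = X y + Y y" for y by simp
  have "Q x (Z x) ((X + Y) x) (V x) = Q x (Z x) (X x) (V x) + Q x (Z x) (Y x) (V x)"
    unfolding e by (rule linear_on_tangent_add[OF non_metricity_linear(2)[OF t[OF Z] t[OF V]] t[OF X] t[OF Y]])
  moreover have "Z x (\<lambda>y. h y ((X + Y) y) (V y)) = Z x (\<lambda>y. h y (X y) (V y)) + Z x (\<lambda>y. h y (Y y) (V y))"
    unfolding e form_left(1)[OF t[OF V] t[OF X] t[OF Y]]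
    by (rule tangent_space_add[OF t[OF Z]]; intro form_smooth X Y V)
  ultimately show ?thesis
    using koszul_form_metric[OF Z VF_add[OF X Y] V, of x] koszul_form_metric[OF Z X V, of x]
      koszul_form_metric[OF Z Y V, of x] fun_cong[OF koszul_form_add[OF Z V X Y], of x]
    by linarith
qed

lemma koszul_form_add_left:
  assumes X: "X \<in> VF" and Y: "Y \<in> VF" and Z: "Z \<in> VF" and V: "V \<in> VF"
  shows "koszul_form (X + Y) Z V x = koszul_form X Z V x + koszul_form Y Z V x"
proof -
  note t = vector_field_tangent
  have "h x (lie_bracket (X + Y) Z x) (V x) = h x (lie_bracket X Z x) (V x) + h x (lie_bracket Y Z x) (V x)"
    unfolding lie_bracket_add_left[OF X Y Z] by (intro form_left(1) t VF_lie_bracket X Y Z V)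
  moreover have "h x (T x ((X + Y) x) (Z x)) (V x) = h x (T x (X x) (Z x)) (V x) + h x (T x (Y x) (Z x)) (V x)"
    unfolding plus_fun_apply[of X Y x] linear_on_tangent_add[OF torsion_linear(2)[OF t[OF Z]] t[OF X] t[OF Y]]
    by (intro form_left(1) t[OF V] torsion_tangent X Y Z)
  ultimately show ?thesis
    using koszul_form_torsion[OF VF_add[OF X Y] Z V, of x] koszul_form_torsion[OF X Z V, of x]
      koszul_form_torsion[OF Y Z V, of x] koszul_form_add_middle[OF X Y Z V, of x] by linarith
qed

lemma koszul_form_scale_middle:
  assumes f: "f \<in> SF" and X: "X \<in> VF" and Y: "Y \<in> VF" and V: "V \<in> VF"
  shows "koszul_form X (\<lambda>x. f x *\<^sub>R Y x) V x = f x * koszul_form X Y V x + 2 * X x f * h x (Y x) (V x)"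
proof -
  note t = vector_field_tangent
  have l: "h y (f y *\<^sub>R Y y) (V y) = f y * h y (Y y) (V y)" for y
    using form_left(2)[OF t[OF V] t[OF Y]] by simp
  have q: "Q x (X x) (f x *\<^sub>R Y x) (V x) = f x * Q x (X x) (Y x) (V x)"
    using linear_on_tangent_scale[OF non_metricity_linear(2)[OF t[OF X] t[OF V]] t[OF Y]] by simp
  have d: "X x (\<lambda>y. h y (f y *\<^sub>R Y y) (V y)) = f x * X x (\<lambda>y. h y (Y y) (V y)) + h x (Y x) (V x) * X x f"
    unfolding l by (rule tangent_space_mult[OF t[OF X] f]; intro form_smooth Y V)
  have k: "koszul_form X V (\<lambda>x. f x *\<^sub>R Y x) x = f x * koszul_form X V Y x"
    by (rule fun_cong[OF koszul_form_scale[OF X V Y f]])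
  have E: "koszul_form X (\<lambda>x. f x *\<^sub>R Y x) V x =
      2 * (f x * X x (\<lambda>y. h y (Y y) (V y)) + h x (Y x) (V x) * X x f)
      - 2 * (f x * Q x (X x) (Y x) (V x)) - f x * koszul_form X V Y x"
    using koszul_form_metric[OF X VF_scale[OF f Y] V, of x] unfolding q d k by (simp only: eq_diff_eq)
  have E': "koszul_form X V Y x =
      2 * X x (\<lambda>y. h y (Y y) (V y)) - 2 * Q x (X x) (Y x) (V x) - koszul_form X Y V x"
    using koszul_form_metric[OF X Y V, of x] by linarith
  show ?thesis unfolding E unfolding E' by (simp add: algebra_simps)
qed

lemma koszul_form_scale_left:
  assumes f: "f \<in> SF" and X: "X \<in> VF" and Y: "Y \<in> VF" and V: "V \<in> VF"
  shows "koszul_form (\<lambda>x. f x *\<^sub>R X x) Y V x = f x * koszul_form X Y V x"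
proof -
  note t = vector_field_tangent
  have "h x (lie_bracket (\<lambda>x. f x *\<^sub>R X x) Y x) (V x) = f x * h x (lie_bracket X Y x) (V x) - Y x f * h x (X x) (V x)"
    unfolding lie_bracket_scale_left[OF f X Y]
    using form_left(5)[OF t[OF V] tangent_space_closed(2)[OF t[OF VF_lie_bracket[OF X Y]]] tangent_space_closed(2)[OF t[OF X]]]
      form_left(2)[OF t[OF V] t[OF VF_lie_bracket[OF X Y]]] form_left(2)[OF t[OF V] t[OF X]] by simp
  moreover have "h x (T x (f x *\<^sub>R X x) (Y x)) (V x) = f x * h x (T x (X x) (Y x)) (V x)"
    using linear_on_tangent_scale[OF torsion_linear(2)[OF t[OF Y]] t[OF X]]
      form_left(2)[OF t[OF V] torsion_tangent[OF X Y]] by simp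
  ultimately have E: "koszul_form (\<lambda>x. f x *\<^sub>R X x) Y V x = f x * koszul_form Y X V x
      + 2 * (f x * h x (lie_bracket X Y x) (V x)) + 2 * (f x * h x (T x (X x) (Y x)) (V x))"
    using koszul_form_torsion[OF VF_scale[OF f X] Y V, of x] koszul_form_scale_middle[OF f Y X V, of x]
    by linarith
  have E': "koszul_form Y X V x =
      koszul_form X Y V x - 2 * h x (lie_bracket X Y x) (V x) - 2 * h x (T x (X x) (Y x)) (V x)"
    using koszul_form_torsion[OF X Y V, of x] by linarith
  show ?thesis unfolding E unfolding E' by (simp add: algebra_simps)
qed

lemma koszul_field_exists:
  assumes "X \<in> VF" "Y \<in> VF"
  shows "\<exists>W\<in>VF. \<forall>Z\<in>VF. \<forall>x. h x (W x) (Z x) = koszul_form X Y Z x / 2"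
proof (rule form_represents)
  show "(\<lambda>x. koszul_form X Y Z x / 2) \<in> SF" if "Z \<in> VF" for Z
    using SF_mult[OF SF_const[of "1/2"] koszul_form_smooth[OF assms that]] by simp
  show "(\<lambda>x. koszul_form X Y (V + Z) x / 2) = (\<lambda>x. koszul_form X Y V x / 2 + koszul_form X Y Z x / 2)"
    if "V \<in> VF" "Z \<in> VF" for V Z
    unfolding koszul_form_add[OF assms that] by (simp add: add_divide_distrib)
  show "(\<lambda>x. koszul_form X Y (\<lambda>x. f x *\<^sub>R Z x) x / 2) = (\<lambda>x. f x * (koszul_form X Y Z x / 2))"
    if "f \<in> SF" "Z \<in> VF" for f Z
    unfolding koszul_form_scale[OF assms that(2,1)] by simp
qed

definition koszul_connection :: "'a vfield \<Rightarrow> 'a vfield \<Rightarrow> 'a vfield" where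
  "koszul_connection = (\<lambda>X\<in>VF. \<lambda>Y\<in>VF.
     SOME W. W \<in> VF \<and> (\<forall>Z\<in>VF. \<forall>x. h x (W x) (Z x) = koszul_form X Y Z x / 2))"

lemma koszul_connection:
  assumes "X \<in> VF" "Y \<in> VF"
  shows koszul_connection_VF: "koszul_connection X Y \<in> VF"
    and koszul_connection_form: "Z \<in> VF \<Longrightarrow> h x (koszul_connection X Y x) (Z x) = koszul_form X Y Z x / 2"
proof -
  have "koszul_connection X Y \<in> VF \<and>
    (\<forall>Z\<in>VF. \<forall>x. h x (koszul_connection X Y x) (Z x) = koszul_form X Y Z x / 2)"
    unfolding koszul_connection_def restrict_apply if_P[OF assms(1)] if_P[OF assms(2)]
    using koszul_field_exists[OF assms] by (intro someI_ex[of "\<lambda>W. W \<in> VF \<and>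
      (\<forall>Z\<in>VF. \<forall>x. h x (W x) (Z x) = koszul_form X Y Z x / 2)"]) blast
  then show "koszul_connection X Y \<in> VF"
    "Z \<in> VF \<Longrightarrow> h x (koszul_connection X Y x) (Z x) = koszul_form X Y Z x / 2" by blast+
qed

lemma fields_eqI:
  assumes "U \<in> VF" "V \<in> VF" "\<And>Z x. Z \<in> VF \<Longrightarrow> h x (U x) (Z x) = h x (V x) (Z x)"
  shows "U = V"
proof
  show "U x = V x" for x
    by (rule form_determines_tangent[OF vector_field_tangent[OF assms(1)]
          vector_field_tangent[OF assms(2)] assms(3)])
qed

theorem koszul_connection_linear: "linear_connection A koszul_connection"
  unfolding linear_connection_def
proof (intro conjI ballI allI)
  show "koszul_connection \<in> VF \<rightarrow>\<^sub>E (VF \<rightarrow>\<^sub>E VF)"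
  proof (rule PiE_I)
    show "koszul_connection X \<in> VF \<rightarrow>\<^sub>E VF" if "X \<in> VF" for X
      by (rule PiE_I) (use that koszul_connection_VF in \<open>simp_all add: koszul_connection_def\<close>)
  qed (simp add: koszul_connection_def)
next
  note t = vector_field_tangent and n = koszul_connection_VF and F = koszul_connection_form
  fix X Y Z assume X: "X \<in> VF" and Y: "Y \<in> VF" and Z: "Z \<in> VF"
  show "koszul_connection (X + Y) Z = koszul_connection X Z + koszul_connection Y Z"
  proof (rule fields_eqI)
    show "h x (koszul_connection (X + Y) Z x) (V x) = h x ((koszul_connection X Z + koszul_connection Y Z) x) (V x)"
      if V: "V \<in> VF" for V x
      unfolding plus_fun_apply[of "koszul_connection X Z" _ x] form_left(1)[OF t[OF V] t[OF n[OF X Z]] t[OF n[OF Y Z]]]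
        F[OF VF_add[OF X Y] Z V] F[OF X Z V] F[OF Y Z V] koszul_form_add_left[OF X Y Z V] by (rule add_divide_distrib)
  qed (intro VF_add n X Y Z)+
  show "koszul_connection Z (X + Y) = koszul_connection Z X + koszul_connection Z Y"
  proof (rule fields_eqI)
    show "h x (koszul_connection Z (X + Y) x) (V x) = h x ((koszul_connection Z X + koszul_connection Z Y) x) (V x)"
      if V: "V \<in> VF" for V x
      unfolding plus_fun_apply[of "koszul_connection Z X" _ x] form_left(1)[OF t[OF V] t[OF n[OF Z X]] t[OF n[OF Z Y]]]
        F[OF Z VF_add[OF X Y] V] F[OF Z X V] F[OF Z Y V] koszul_form_add_middle[OF X Y Z V] by (rule add_divide_distrib)
  qed (intro VF_add n X Y Z)+
next
  note t = vector_field_tangent and n = koszul_connection_VF and F = koszul_connection_form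
  have right_scale: "koszul_connection X (\<lambda>x. f x *\<^sub>R Y x) =
      (\<lambda>x. X x f *\<^sub>R Y x + f x *\<^sub>R koszul_connection X Y x)"
    if f: "f \<in> SF" and X: "X \<in> VF" and Y: "Y \<in> VF" for f X Y
  proof (rule fields_eqI)
    have "(\<lambda>x. X x f *\<^sub>R Y x) + (\<lambda>x. f x *\<^sub>R koszul_connection X Y x) \<in> VF"
      by (intro VF_add VF_scale vector_field_smooth[OF X] n f X Y)
    then show "(\<lambda>x. X x f *\<^sub>R Y x + f x *\<^sub>R koszul_connection X Y x) \<in> VF"
      by (simp only: plus_fun_def[of "\<lambda>x. X x f *\<^sub>R Y x"])
    fix V x assume V: "V \<in> VF"
    have "h x (X x f *\<^sub>R Y x + f x *\<^sub>R koszul_connection X Y x) (V x) =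
        X x f * h x (Y x) (V x) + f x * (koszul_form X Y V x / 2)"
      using form_left(1)[OF t[OF V] tangent_space_closed(2)[OF t[OF Y]] tangent_space_closed(2)[OF t[OF n[OF X Y]]]]
        form_left(2)[OF t[OF V] t[OF Y]] form_left(2)[OF t[OF V] t[OF n[OF X Y]]] F[OF X Y V] by simp
    then show "h x (koszul_connection X (\<lambda>x. f x *\<^sub>R Y x) x) (V x) =
        h x (X x f *\<^sub>R Y x + f x *\<^sub>R koszul_connection X Y x) (V x)"
      unfolding F[OF X VF_scale[OF f Y] V] koszul_form_scale_middle[OF f X Y V] by simp
  qed (intro n VF_scale f X Y)
  {
    fix f X Y assume f: "f \<in> SF" and X: "X \<in> VF" and Y: "Y \<in> VF"
    show "koszul_connection X (\<lambda>x. f x *\<^sub>R Y x) = (\<lambda>x. X x f *\<^sub>R Y x + f x *\<^sub>R koszul_connection X Y x)"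
      by (rule right_scale[OF f X Y])
    show "koszul_connection (\<lambda>x. f x *\<^sub>R X x) Y = (\<lambda>x. f x *\<^sub>R koszul_connection X Y x)"
    proof (rule fields_eqI)
      show "h x (koszul_connection (\<lambda>x. f x *\<^sub>R X x) Y x) (V x) = h x (f x *\<^sub>R koszul_connection X Y x) (V x)"
        if V: "V \<in> VF" for V x
        using form_left(2)[OF t[OF V] t[OF n[OF X Y]]]
        by (simp add: F[OF VF_scale[OF f X] Y V] F[OF X Y V] koszul_form_scale_left[OF f X Y V])
    qed (intro n VF_scale f X Y)+
  next
    fix c X Y assume X: "X \<in> VF" and Y: "Y \<in> VF"
    have c: "c *\<^sub>R V = (\<lambda>x. c *\<^sub>R V x)" for V :: "'a vfield" by (rule scaleR_fun_def)
    show "koszul_connection X (c *\<^sub>R Y) = c *\<^sub>R koszul_connection X Y"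
      unfolding c right_scale[OF SF_const X Y] tangent_space_const[OF t[OF X]]
      by simp
  }
qed

lemma koszul_connection_torsion:
  assumes X: "X \<in> VF" and Y: "Y \<in> VF"
  shows "torsion koszul_connection X Y x = T x (X x) (Y x)"
proof (rule form_determines_tangent)
  note t = vector_field_tangent and n = koszul_connection_VF and F = koszul_connection_form
  note tt = t[OF n[OF X Y], of x] t[OF n[OF Y X], of x] t[OF VF_lie_bracket[OF X Y], of x]
  have e: "torsion koszul_connection X Y x =
      koszul_connection X Y x - koszul_connection Y X x - lie_bracket X Y x"
    by (simp add: torsion_def)
  show "torsion koszul_connection X Y x \<in> TS x"
    unfolding e by (intro tangent_space_closed tt)
  show "T x (X x) (Y x) \<in> TS x" by (rule torsion_tangent[OF X Y])
  fix Z assume Z: "Z \<in> VF"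
  have "h x (torsion koszul_connection X Y x) (Z x) =
      koszul_form X Y Z x / 2 - koszul_form Y X Z x / 2 - h x (lie_bracket X Y x) (Z x)"
    unfolding e form_left(5)[OF t[OF Z] tangent_space_closed(5)[OF tt(1,2)] tt(3)]
      form_left(5)[OF t[OF Z] tt(1,2)] F[OF X Y Z] F[OF Y X Z] ..
  then show "h x (torsion koszul_connection X Y x) (Z x) = h x (T x (X x) (Y x)) (Z x)"
    using koszul_form_torsion[OF X Y Z, of x] by linarith
qed

lemma koszul_connection_metric:
  assumes X: "X \<in> VF" and Y: "Y \<in> VF" and Z: "Z \<in> VF"
  shows "cov_deriv_metric koszul_connection h Z X Y x = Q x (Z x) (X x) (Y x)"
proof -
  have "h x (X x) (koszul_connection Z Y x) = h x (koszul_connection Z Y x) (X x)"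
    by (intro form_sym vector_field_tangent koszul_connection_VF X Y Z)
  then show ?thesis
    using koszul_form_metric[OF Z X Y, of x]
    unfolding cov_deriv_metric_def koszul_connection_form[OF Z X Y]
    by (simp add: koszul_connection_form[OF Z Y X])
qed

text \<open>Rewrite each derivative of \<open>h\<close> by non-metricity. The torsion equations then identify \<open>\<nabla>\<^sub>Y X\<close> with
  \<open>\<nabla>\<^sub>X Y\<close>, \<open>\<nabla>\<^sub>X Z\<close> with
  \<open>\<nabla>\<^sub>Z X\<close> and \<open>\<nabla>\<^sub>Y Z\<close> with \<open>\<nabla>\<^sub>Z Y\<close> up to bracket and torsion terms, and only \<open>\<nabla>\<^sub>X Y\<close> is left.\<close>

lemma koszul_formula:
  assumes nab: "linear_connection A nab"
    and torsion: "\<And>X Y x. X \<in> VF \<Longrightarrow> Y \<in> VF \<Longrightarrow> torsion nab X Y x = T x (X x) (Y x)"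
    and metric: "\<And>X Y Z x. X \<in> VF \<Longrightarrow> Y \<in> VF \<Longrightarrow> Z \<in> VF \<Longrightarrow>
      cov_deriv_metric nab h Z X Y x = Q x (Z x) (X x) (Y x)"
    and X: "X \<in> VF" and Y: "Y \<in> VF" and Z: "Z \<in> VF"
  shows "h x (nab X Y x) (Z x) = koszul_form X Y Z x / 2"
proof -
  have n: "nab U V \<in> VF" if "U \<in> VF" "V \<in> VF" for U V
    by (rule PiE_mem[OF PiE_mem[OF nab[unfolded linear_connection_def, THEN conjunct1] that(1)] that(2)])
  note t = vector_field_tangent
  have m: "U x (\<lambda>y. h y (V y) (W y)) = h x (nab U V x) (W x) + h x (nab U W x) (V x) + Q x (U x) (V x) (W x)"
    if "U \<in> VF" "V \<in> VF" "W \<in> VF" for U V W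
    using metric[OF that(2,3,1), of x] form_sym[OF t[OF that(2)] t[OF n[OF that(1,3)]], of x]
    by (simp add: cov_deriv_metric_def)
  have s: "h x (nab U V x) (W x) = h x (nab V U x) (W x) + h x (lie_bracket U V x) (W x) + h x (T x (U x) (V x)) (W x)"
    if U: "U \<in> VF" and V: "V \<in> VF" and W: "W \<in> VF" for U V W
  proof -
    have "T x (U x) (V x) = nab U V x - nab V U x - lie_bracket U V x"
      using torsion[OF U V, of x] by (simp add: torsion_def)
    then show ?thesis
      using form_left(5)[OF t[OF W] tangent_space_closed(5)[OF t[OF n[OF U V]] t[OF n[OF V U]]] t[OF VF_lie_bracket[OF U V]]]
        form_left(5)[OF t[OF W] t[OF n[OF U V]] t[OF n[OF V U]]] by simp
  qed
  show ?thesis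
    unfolding koszul_form_def m[OF X Y Z] m[OF Y X Z] m[OF Z X Y]
      s[OF X Y Z] s[OF X Z Y] s[OF Y Z X]
    by simp
qed

theorem koszul_unique:
  assumes nab: "linear_connection A nab"
    and torsion: "\<And>X Y x. X \<in> VF \<Longrightarrow> Y \<in> VF \<Longrightarrow> torsion nab X Y x = T x (X x) (Y x)"
    and metric: "\<And>X Y Z x. X \<in> VF \<Longrightarrow> Y \<in> VF \<Longrightarrow> Z \<in> VF \<Longrightarrow>
      cov_deriv_metric nab h Z X Y x = Q x (Z x) (X x) (Y x)"
  shows "nab = koszul_connection"
proof -
  have P: "nab \<in> VF \<rightarrow>\<^sub>E (VF \<rightarrow>\<^sub>E VF)" "koszul_connection \<in> VF \<rightarrow>\<^sub>E (VF \<rightarrow>\<^sub>E VF)"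
    by (rule nab[unfolded linear_connection_def, THEN conjunct1]
        koszul_connection_linear[unfolded linear_connection_def, THEN conjunct1])+
  have "nab X Y = koszul_connection X Y" if X: "X \<in> VF" and Y: "Y \<in> VF" for X Y
  proof (rule fields_eqI)
    show "nab X Y \<in> VF" by (rule PiE_mem[OF PiE_mem[OF P(1) X] Y])
    show "koszul_connection X Y \<in> VF" by (rule koszul_connection_VF[OF X Y])
    show "h x (nab X Y x) (Z x) = h x (koszul_connection X Y x) (Z x)" if Z: "Z \<in> VF" for Z x
      unfolding koszul_connection_form[OF X Y Z] by (rule koszul_formula[OF nab torsion metric X Y Z])
  qed
  then have "nab X = koszul_connection X" if X: "X \<in> VF" for X
    using PiE_ext[OF PiE_mem[OF P(1) X] PiE_mem[OF P(2) X]] X by blast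
  then show ?thesis by (rule PiE_ext[OF P])
qed

end


section \<open>Light-like manifolds with a framed radical\<close>

locale framed_radical = manifold +
  fixes g :: "'a \<Rightarrow> 'a tvec \<Rightarrow> 'a tvec \<Rightarrow> real"
    and r :: nat
    and \<xi> :: "nat \<Rightarrow> 'a vfield"
    and \<tau> :: "nat \<Rightarrow> 'a \<Rightarrow> 'a tvec \<Rightarrow> real"
  assumes g: "tensor_0_2 A g"
    and g_sym: "u \<in> TS x \<Longrightarrow> v \<in> TS x \<Longrightarrow> g x u v = g x v u"
    and dim_radical: "dim (radical A g x) = r"
    and \<xi>: "i \<in> {1..r} \<Longrightarrow> \<xi> i \<in> radical_sections A g"
    and \<xi>_inj: "inj_on (\<lambda>i. \<xi> i x) {1..r}"
    and \<xi>_independent: "independent ((\<lambda>i. \<xi> i x) ` {1..r})"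
    and \<tau>: "i \<in> {1..r} \<Longrightarrow> one_form A (\<tau> i)"
    and dual: "i \<in> {1..r} \<Longrightarrow> j \<in> {1..r} \<Longrightarrow> \<tau> i x (\<xi> j x) = (if i = j then 1 else 0)"
begin

definition completed_form :: "'a \<Rightarrow> 'a tvec \<Rightarrow> 'a tvec \<Rightarrow> real" where
  "completed_form x u v = g x u v + (\<Sum>i\<in>{1..r}. \<tau> i x u * \<tau> i x v)"

lemma \<xi>_VF: "i \<in> {1..r} \<Longrightarrow> \<xi> i \<in> VF"
  and \<xi>_radical: "i \<in> {1..r} \<Longrightarrow> \<xi> i x \<in> radical A g x"
  using \<xi> unfolding radical_sections_def by auto

lemma g_\<xi>: "i \<in> {1..r} \<Longrightarrow> w \<in> TS x \<Longrightarrow> g x (\<xi> i x) w = 0"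
  using \<xi>_radical unfolding radical_def by blast

lemma \<tau>_linear: "i \<in> {1..r} \<Longrightarrow> linear_on_tangent A x (\<tau> i x)"
  and \<tau>_smooth: "i \<in> {1..r} \<Longrightarrow> X \<in> VF \<Longrightarrow> (\<lambda>x. \<tau> i x (X x)) \<in> SF"
  using \<tau> unfolding one_form_def by blast+

lemma g_linear:
  "w \<in> TS x \<Longrightarrow> linear_on_tangent A x (\<lambda>v. g x w v)"
  "w \<in> TS x \<Longrightarrow> linear_on_tangent A x (\<lambda>v. g x v w)"
  using g unfolding tensor_0_2_def by blast+

lemma g_smooth: "X \<in> VF \<Longrightarrow> Y \<in> VF \<Longrightarrow> (\<lambda>x. g x (X x) (Y x)) \<in> SF"
  using g unfolding tensor_0_2_def by blast

text \<open>A further independent vector would make \<open>r + 1\<close> independent vectors in a space of dimension \<open>r\<close>.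
  Finite dimension of the tangent space is essential: in the ambient space of functionals a subspace without a
  finite basis has \<open>dim\<close> zero.\<close>

lemma radical_subset_span: "radical A g x \<subseteq> span ((\<lambda>i. \<xi> i x) ` {1..r})"
proof
  let ?S = "(\<lambda>i. \<xi> i x) ` {1..r}"
  fix v assume v: "v \<in> radical A g x"
  show "v \<in> span ?S"
  proof (rule ccontr)
    assume "v \<notin> span ?S"
    then have "v \<notin> ?S" using span_base[of v ?S] by argo
    then have ind: "independent (insert v ?S)"
      using \<xi>_independent \<open>v \<notin> span ?S\<close> by (simp add: independent_insert)
    obtain B where B: "B \<subseteq> radical A g x" "independent B" "radical A g x \<subseteq> span B" "card B = r"
      using basis_exists[of "radical A g x"] dim_radical by metis
    obtain C where "finite C" "TS x \<subseteq> span C" using tangent_space_finite_span by blast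
    then have "finite B"
      using independent_span_bound[OF _ B(2)] B(1) unfolding radical_def by blast
    moreover have "insert v ?S \<subseteq> span B" using v B(3) \<xi>_radical by auto
    ultimately have "card (insert v ?S) \<le> r"
      using independent_span_bound[OF _ ind, of B] B(4) by simp
    then show False using \<open>v \<notin> ?S\<close> card_image[OF \<xi>_inj] by simp
  qed
qed

lemma completed_form_\<xi>:
  assumes i: "i \<in> {1..r}" and v: "v \<in> TS x"
  shows "completed_form x v (\<xi> i x) = \<tau> i x v"
proof -
  have "g x v (\<xi> i x) = 0"
    using g_\<xi>[OF i v] g_sym[OF v vector_field_tangent[OF \<xi>_VF[OF i]]] by simp
  moreover have "(\<Sum>j\<in>{1..r}. \<tau> j x v * \<tau> j x (\<xi> i x)) = (\<Sum>j\<in>{1..r}. if j = i then \<tau> j x v else 0)"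
    by (rule sum.cong) (use dual i in auto)
  ultimately show ?thesis using i by (simp add: completed_form_def)
qed

text \<open>A vector in the kernel is annihilated by each \<open>\<tau> i\<close>, as the test against \<open>\<xi> i\<close> shows. It then lies
  in the radical of \<open>g\<close>, and its coefficients in the frame \<open>\<xi>\<close> are its values under the \<open>\<tau> i\<close>.\<close>

lemma completed_form_nondegenerate: "nondegenerate_form A completed_form"
proof unfold_locales
  show "tensor_0_2 A completed_form"
    unfolding tensor_0_2_def
  proof (intro conjI allI ballI)
    fix x u assume u: "u \<in> TS x"
    show "linear_on_tangent A x (\<lambda>v. completed_form x u v)"
      using g_linear(1)[OF u] \<tau>_linear
      by (auto simp: linear_on_tangent_def completed_form_def distrib_left sum.distrib
          sum_distrib_left mult_ac intro!: sum.cong)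
    show "linear_on_tangent A x (\<lambda>v. completed_form x v u)"
      using g_linear(2)[OF u] \<tau>_linear
      by (auto simp: linear_on_tangent_def completed_form_def distrib_left distrib_right sum.distrib
          sum_distrib_left mult_ac intro!: sum.cong)
  next
    fix X Y assume "X \<in> VF" "Y \<in> VF"
    then show "(\<lambda>x. completed_form x (X x) (Y x)) \<in> SF"
      unfolding completed_form_def by (intro SF_add SF_sum SF_mult g_smooth \<tau>_smooth)
  qed
  show "completed_form x u v = completed_form x v u" if "u \<in> TS x" "v \<in> TS x" for x u v
    using g_sym[OF that] by (simp add: completed_form_def mult.commute)
  fix u x assume u: "u \<in> TS x" and 0: "\<And>w. w \<in> TS x \<Longrightarrow> completed_form x u w = 0"
  have \<tau>0: "\<tau> i x u = 0" if i: "i \<in> {1..r}" for i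
    using 0[OF vector_field_tangent[OF \<xi>_VF[OF i]]] completed_form_\<xi>[OF i u] by simp
  then have "u \<in> radical A g x"
    using u 0 by (simp add: radical_def completed_form_def)
  then have "u \<in> span ((\<lambda>i. \<xi> i x) ` {1..r})" using radical_subset_span by blast
  then obtain a where a: "u = (\<Sum>v\<in>(\<lambda>i. \<xi> i x) ` {1..r}. a v *\<^sub>R v)"
    by (auto simp: span_finite)
  define c where "c i = a (\<xi> i x)" for i
  have c: "u = (\<Sum>i\<in>{1..r}. c i *\<^sub>R \<xi> i x)"
    unfolding a c_def sum.reindex[OF \<xi>_inj] o_def ..
  have "c i = 0" if i: "i \<in> {1..r}" for i
  proof -
    have T: "\<xi> j x \<in> TS x" if "j \<in> {1..r}" for j by (rule vector_field_tangent[OF \<xi>_VF[OF that]])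
    have "0 = \<tau> i x (\<Sum>j\<in>{1..r}. c j *\<^sub>R \<xi> j x)" using \<tau>0[OF i] c by simp
    also have "\<dots> = (\<Sum>j\<in>{1..r}. \<tau> i x (c j *\<^sub>R \<xi> j x))"
      by (rule linear_on_tangent_sum[OF \<tau>_linear[OF i]]) (rule tangent_space_closed(2)[OF T])
    also have "\<dots> = (\<Sum>j\<in>{1..r}. if j = i then c j else 0)"
      by (rule sum.cong) (use linear_on_tangent_scale[OF \<tau>_linear[OF i] T] dual i in auto)
    also have "\<dots> = c i" using i by simp
    finally show ?thesis by simp
  qed
  then show "u = 0" unfolding c by simp
qed

lemma derivative_completed_form:
  assumes X: "X \<in> VF" and Y: "Y \<in> VF" and Z: "Z \<in> VF"
  shows "Z x (\<lambda>y. completed_form y (X y) (Y y)) = Z x (\<lambda>y. g y (X y) (Y y)) +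
    (\<Sum>i\<in>{1..r}. \<tau> i x (X x) * Z x (\<lambda>y. \<tau> i y (Y y)) + \<tau> i x (Y x) * Z x (\<lambda>y. \<tau> i y (X y)))"
proof -
  note tZ = vector_field_tangent[OF Z]
  have smooth: "(\<lambda>y. \<tau> i y (X y) * \<tau> i y (Y y)) \<in> SF" if "i \<in> {1..r}" for i
    by (intro SF_mult \<tau>_smooth that X Y)
  have "Z x (\<lambda>y. completed_form y (X y) (Y y)) =
      Z x (\<lambda>y. g y (X y) (Y y)) + Z x (\<lambda>y. \<Sum>i\<in>{1..r}. \<tau> i y (X y) * \<tau> i y (Y y))"
    unfolding completed_form_def by (rule tangent_space_add[OF tZ g_smooth[OF X Y] SF_sum[OF smooth]])
  also have "Z x (\<lambda>y. \<Sum>i\<in>{1..r}. \<tau> i y (X y) * \<tau> i y (Y y)) =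
      (\<Sum>i\<in>{1..r}. Z x (\<lambda>y. \<tau> i y (X y) * \<tau> i y (Y y)))"
    by (rule tangent_space_sum[OF tZ smooth])
  also have "\<dots> = (\<Sum>i\<in>{1..r}. \<tau> i x (X x) * Z x (\<lambda>y. \<tau> i y (Y y)) + \<tau> i x (Y x) * Z x (\<lambda>y. \<tau> i y (X y)))"
    by (intro sum.cong refl tangent_space_mult[OF tZ] \<tau>_smooth X Y)
  finally show ?thesis .
qed

text \<open>Each summand \<open>\<tau>\<^sub>i \<otimes> \<tau>\<^sub>i\<close> obeys the product rule, so parallel forms \<open>\<tau>\<^sub>i\<close> add nothing to the
  non-metricity.\<close>

lemma cov_deriv_metric_completed_form:
  assumes nab: "linear_connection A nab" and X: "X \<in> VF" and Y: "Y \<in> VF" and Z: "Z \<in> VF"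
  shows "cov_deriv_metric nab completed_form Z X Y x = cov_deriv_metric nab g Z X Y x
    + (\<Sum>i\<in>{1..r}. \<tau> i x (X x) * cov_deriv_form nab (\<tau> i) Z Y x + \<tau> i x (Y x) * cov_deriv_form nab (\<tau> i) Z X x)"
  using derivative_completed_form[OF X Y Z, of x]
  by (simp add: cov_deriv_metric_def cov_deriv_form_def completed_form_def algebra_simps
      sum.distrib sum_subtractf)

end

locale lightlike_koszul = framed_radical +
  fixes T :: "'a \<Rightarrow> 'a tvec \<Rightarrow> 'a tvec \<Rightarrow> 'a tvec"
    and Q :: "'a \<Rightarrow> 'a tvec \<Rightarrow> 'a tvec \<Rightarrow> 'a tvec \<Rightarrow> real"
  assumes T: "torsion_tensor A T" and Q: "non_metricity_tensor A Q"
    and d\<tau>: "i \<in> {1..r} \<Longrightarrow> X \<in> VF \<Longrightarrow> Y \<in> VF \<Longrightarrow> ext_deriv (\<tau> i) X Y x = \<tau> i x (T x (X x) (Y x))"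
    and L\<xi>: "i \<in> {1..r} \<Longrightarrow> X \<in> VF \<Longrightarrow> Y \<in> VF \<Longrightarrow> lie_deriv (\<xi> i) g X Y x =
           g x (X x) (T x (\<xi> i x) (Y x)) + g x (Y x) (T x (\<xi> i x) (X x))
           + Q x (\<xi> i x) (X x) (Y x) - Q x (X x) (Y x) (\<xi> i x) - Q x (Y x) (X x) (\<xi> i x)"

sublocale lightlike_koszul \<subseteq> koszul A completed_form T Q
  using completed_form_nondegenerate T Q by (simp add: koszul_def koszul_axioms_def)

context lightlike_koszul
begin

text \<open>The condition on \<open>d\<tau>\<^sub>j\<close> evaluated at \<open>(\<xi>\<^sub>i, V)\<close> gives \<open>(L\<^sub>\<xi> \<tau>\<^sub>j)(V) = \<tau>\<^sub>j(T(\<xi>\<^sub>i, V))\<close>, because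
  \<open>\<tau>\<^sub>j(\<xi>\<^sub>i)\<close> is constant. By the product rule each \<open>\<tau>\<^sub>j \<otimes> \<tau>\<^sub>j\<close> then contributes to the Lie derivative
  exactly its share of the torsion terms.\<close>

lemma lie_deriv_completed_form:
  assumes i: "i \<in> {1..r}" and X: "X \<in> VF" and Y: "Y \<in> VF"
  shows "lie_deriv (\<xi> i) completed_form X Y x =
    completed_form x (X x) (T x (\<xi> i x) (Y x)) + completed_form x (Y x) (T x (\<xi> i x) (X x))
    + Q x (\<xi> i x) (X x) (Y x) - Q x (X x) (Y x) (\<xi> i x) - Q x (Y x) (X x) (\<xi> i x)"
proof -
  note \<xi>i = \<xi>_VF[OF i]
  have L\<tau>: "\<xi> i x (\<lambda>y. \<tau> j y (V y)) = \<tau> j x (lie_bracket (\<xi> i) V x) + \<tau> j x (T x (\<xi> i x) (V x))"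
    if j: "j \<in> {1..r}" and V: "V \<in> VF" for j V
  proof -
    have "V x (\<lambda>y. \<tau> j y (\<xi> i y)) = 0"
      using dual[OF j i] tangent_space_const[OF vector_field_tangent[OF V]] by simp
    then show ?thesis using d\<tau>[OF j \<xi>i V, of x] by (simp add: ext_deriv_def)
  qed
  have "\<xi> i x (\<lambda>y. completed_form y (X y) (Y y)) = \<xi> i x (\<lambda>y. g y (X y) (Y y)) + (\<Sum>j\<in>{1..r}.
      \<tau> j x (X x) * \<xi> i x (\<lambda>y. \<tau> j y (Y y)) + \<tau> j x (Y x) * \<xi> i x (\<lambda>y. \<tau> j y (X y)))"
    by (rule derivative_completed_form[OF X Y \<xi>i])
  also have "(\<Sum>j\<in>{1..r}. \<tau> j x (X x) * \<xi> i x (\<lambda>y. \<tau> j y (Y y)) + \<tau> j x (Y x) * \<xi> i x (\<lambda>y. \<tau> j y (X y)))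
      = (\<Sum>j\<in>{1..r}. \<tau> j x (X x) * (\<tau> j x (lie_bracket (\<xi> i) Y x) + \<tau> j x (T x (\<xi> i x) (Y x)))
      + \<tau> j x (Y x) * (\<tau> j x (lie_bracket (\<xi> i) X x) + \<tau> j x (T x (\<xi> i x) (X x))))"
    by (intro sum.cong refl) (simp only: L\<tau> X Y)
  finally show ?thesis
    using L\<xi>[OF i X Y, of x]
    by (simp add: lie_deriv_def completed_form_def distrib_left sum.distrib mult_ac)
qed

text \<open>Put \<open>Z = \<xi>\<^sub>i\<close> in the Koszul expression, where pairing with \<open>\<xi>\<^sub>i\<close> is the same as applying \<open>\<tau>\<^sub>i\<close>. The terms that
  do not pair with \<open>\<xi>\<^sub>i\<close> make up the identity for the Lie derivative and cancel; the condition on \<open>d\<tau>\<^sub>i\<close>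
  turns the rest into \<open>2 X(\<tau>\<^sub>i(Y))\<close>.\<close>

lemma koszul_connection_parallel:
  assumes i: "i \<in> {1..r}" and X: "X \<in> VF" and Y: "Y \<in> VF"
  shows "cov_deriv_form koszul_connection (\<tau> i) X Y x = 0"
proof -
  note \<xi>i = \<xi>_VF[OF i]
  note t = vector_field_tangent
  note b = VF_lie_bracket[OF \<xi>i]
  have \<tau>i: "(\<lambda>y. completed_form y (V y) (\<xi> i y)) = (\<lambda>y. \<tau> i y (V y))" if "V \<in> VF" for V
    by (intro ext completed_form_\<xi>[OF i] t that)
  have br: "lie_bracket V (\<xi> i) x = - lie_bracket (\<xi> i) V x" for V by (rule lie_bracket_antisym)
  have tor: "T x (V x) (\<xi> i x) = - T x (\<xi> i x) (V x)" if "V \<in> VF" for V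
    by (intro torsion_antisym t that \<xi>i)
  have "\<tau> i x (koszul_connection X Y x) = koszul_form X Y (\<xi> i) x / 2"
    using koszul_connection_form[OF X Y \<xi>i, of x] completed_form_\<xi>[OF i t[OF koszul_connection_VF[OF X Y]]]
    by simp
  also have "koszul_form X Y (\<xi> i) x = X x (\<lambda>y. \<tau> i y (Y y)) + Y x (\<lambda>y. \<tau> i y (X y))
      + \<tau> i x (lie_bracket X Y x) + \<tau> i x (T x (X x) (Y x))"
    using lie_deriv_completed_form[OF i X Y, of x]
      form_sym[OF t[OF X] t[OF b[OF Y]], of x] form_sym[OF t[OF X] torsion_tangent[OF \<xi>i Y]]
      form_sym[OF t[OF Y] torsion_tangent[OF \<xi>i X]]
    unfolding koszul_form_def \<tau>i[OF X] \<tau>i[OF Y] br tor[OF X] tor[OF Y]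
      completed_form_\<xi>[OF i t[OF VF_lie_bracket[OF X Y]]] completed_form_\<xi>[OF i torsion_tangent[OF X Y]]
      form_left(4)[OF t[OF Y] t[OF b[OF X]]] form_left(4)[OF t[OF X] t[OF b[OF Y]]]
      form_left(4)[OF t[OF Y] torsion_tangent[OF \<xi>i X]] form_left(4)[OF t[OF X] torsion_tangent[OF \<xi>i Y]]
      lie_deriv_def
    by simp
  finally show ?thesis
    using d\<tau>[OF i X Y, of x] by (simp add: cov_deriv_form_def ext_deriv_def)
qed

end



theorem corollary1p4:
  fixes A :: "('a::{t2_space, second_countable_topology}, 'e::real_inner) chart set"
    and g :: "'a \<Rightarrow> 'a tvec \<Rightarrow> 'a tvec \<Rightarrow> real"
    and q r :: nat
    and \<xi> :: "nat \<Rightarrow> 'a vfield"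
    and \<tau> :: "nat \<Rightarrow> 'a \<Rightarrow> 'a tvec \<Rightarrow> real"
    and T :: "'a \<Rightarrow> 'a tvec \<Rightarrow> 'a tvec \<Rightarrow> 'a tvec"
    and Q :: "'a \<Rightarrow> 'a tvec \<Rightarrow> 'a tvec \<Rightarrow> 'a tvec \<Rightarrow> real"
  assumes lightlike: "lightlike_manifold A g q r"
    and frame_sections: "\<forall>i\<in>{1..r}. \<xi> i \<in> radical_sections A g"
    and frame_independent:
      "\<forall>x. inj_on (\<lambda>i. \<xi> i x) {1..r} \<and> independent ((\<lambda>i. \<xi> i x) ` {1..r})"
    and forms: "\<forall>i\<in>{1..r}. one_form A (\<tau> i)"
    and dual: "\<forall>i\<in>{1..r}. \<forall>j\<in>{1..r}. \<forall>x. \<tau> i x (\<xi> j x) = (if i = j then 1 else 0)"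
    and torsion_T: "torsion_tensor A T"
    and non_metricity_Q: "non_metricity_tensor A Q"
    and ext_deriv_\<tau>:
      "\<forall>i\<in>{1..r}. \<forall>X\<in>vector_fields A. \<forall>Y\<in>vector_fields A. \<forall>x.
         ext_deriv (\<tau> i) X Y x = \<tau> i x (T x (X x) (Y x))"
    and lie_deriv_g:
      "\<forall>i\<in>{1..r}. \<forall>X\<in>vector_fields A. \<forall>Y\<in>vector_fields A. \<forall>x.
         lie_deriv (\<xi> i) g X Y x =
           g x (X x) (T x (\<xi> i x) (Y x)) + g x (Y x) (T x (\<xi> i x) (X x))
           + Q x (\<xi> i x) (X x) (Y x) - Q x (X x) (Y x) (\<xi> i x) - Q x (Y x) (X x) (\<xi> i x)"
  shows "\<exists>!nab. linear_connection A nab \<and>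
    (\<forall>X\<in>vector_fields A. \<forall>Y\<in>vector_fields A. \<forall>x. torsion nab X Y x = T x (X x) (Y x)) \<and>
    (\<forall>Z\<in>vector_fields A. \<forall>X\<in>vector_fields A. \<forall>Y\<in>vector_fields A. \<forall>x.
       cov_deriv_metric nab g Z X Y x = Q x (Z x) (X x) (Y x)) \<and>
    (\<forall>i\<in>{1..r}. \<forall>X\<in>vector_fields A. \<forall>Y\<in>vector_fields A. \<forall>x.
       cov_deriv_form nab (\<tau> i) X Y x = 0)"
proof -
  interpret manifold A
    using lightlike by unfold_locales (simp add: lightlike_manifold_def)
  interpret lightlike_koszul A g r \<xi> \<tau> T Q
  proof unfold_locales
    show "tensor_0_2 A g" "\<And>x. dim (radical A g x) = r"
      "\<And>u x v. u \<in> TS x \<Longrightarrow> v \<in> TS x \<Longrightarrow> g x u v = g x v u"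
      using lightlike unfolding lightlike_manifold_def by blast+
  qed (use frame_sections frame_independent forms dual torsion_T non_metricity_Q ext_deriv_\<tau>
      lie_deriv_g in blast)+
  have metric_iff: "cov_deriv_metric nab completed_form Z X Y x = cov_deriv_metric nab g Z X Y x"
    if "linear_connection A nab" "X \<in> VF" "Y \<in> VF" "Z \<in> VF"
      "\<forall>i\<in>{1..r}. \<forall>X\<in>VF. \<forall>Y\<in>VF. \<forall>x. cov_deriv_form nab (\<tau> i) X Y x = 0" for nab X Y Z x
    using that by (simp add: cov_deriv_metric_completed_form)
  show ?thesis
  proof (rule ex1I[of _ koszul_connection], intro conjI ballI allI)
    show parallel: "cov_deriv_form koszul_connection (\<tau> i) X Y x = 0"
      if "i \<in> {1..r}" "X \<in> VF" "Y \<in> VF" for i X Y x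
      by (rule koszul_connection_parallel[OF that])
    show "cov_deriv_metric koszul_connection g Z X Y x = Q x (Z x) (X x) (Y x)"
      if "Z \<in> VF" "X \<in> VF" "Y \<in> VF" for X Y Z x
      using metric_iff[OF koszul_connection_linear that(2,3,1)] parallel
        koszul_connection_metric[OF that(2,3,1)] by simp
  next
    fix nab
    assume nab: "linear_connection A nab \<and>
    (\<forall>X\<in>VF. \<forall>Y\<in>VF. \<forall>x. torsion nab X Y x = T x (X x) (Y x)) \<and>
    (\<forall>Z\<in>VF. \<forall>X\<in>VF. \<forall>Y\<in>VF. \<forall>x.
       cov_deriv_metric nab g Z X Y x = Q x (Z x) (X x) (Y x)) \<and>
    (\<forall>i\<in>{1..r}. \<forall>X\<in>VF. \<forall>Y\<in>VF. \<forall>x.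
       cov_deriv_form nab (\<tau> i) X Y x = 0)"
    show "nab = koszul_connection"
    proof (rule koszul_unique)
      show "linear_connection A nab" using nab by blast
      show "torsion nab X Y x = T x (X x) (Y x)" if "X \<in> VF" "Y \<in> VF" for X Y x
        using nab that by blast
      show "cov_deriv_metric nab completed_form Z X Y x = Q x (Z x) (X x) (Y x)"
        if "X \<in> VF" "Y \<in> VF" "Z \<in> VF" for X Y Z x
        using nab that metric_iff[of nab X Y Z x] by simp
    qed
  qed (rule koszul_connection_linear koszul_connection_torsion; assumption)+
qed

end
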